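(* Let $\alpha>0$ and let $H_1,H_2,\ldots$ be i.i.d. nonnegative random variables such that $x\mapsto P(H_1>x)$ is regularly varying at infinity with exponent $-\alpha$. For each $n$ let $X_1,\ldots,X_n$ be the associated sample with truncated power tails, with truncation level $M_n$, where $M_n\to\infty$, and auxiliary variables $R_j$ (see context), and let $h_{n,k}$ be its Hill statistic. Assume that $\lim_{n\to\infty}nP(H_1>M_n)=\infty$ (hard truncation regime) and that $$P(H_1>M_n)P(R_1>\epsilon M_n)=o(1/n)\quad\text{for all }\epsilon>0 .$$ Let $\gamma,\beta\in(0,1)$ and $$\hat k_n=\Bigl[n\Bigl(\frac1n\sum_{j=1}^n\mathbf 1\bigl(X_j>\gamma\max_{i=1,\ldots,n}X_i\bigr)\Bigr)^\beta\Bigr],$$ where $[\cdot]$ denotes the integer part. Then $h_{n,\hat k_n}\to1/\alpha$ in probability as $n\to\infty$.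
   Context: Truncated model: $R_1,R_2,\ldots$ are i.i.d. nonnegative random variables independent of $(H_j)$, $M_n>0$ is deterministic, and for each $n$ the sample is $X_j=X_{nj}$, $j=1,\ldots,n$, where $$X_{nj}=H_j\mathbf 1(H_j\le M_n)+(M_n+R_j)\mathbf 1(H_j>M_n).$$ Hill statistic: with $X_{(1)}\ge X_{(2)}\ge\cdots\ge X_{(n)}$ the order statistics of $X_1,\ldots,X_n$, $$h_{n,k}=\frac1k\sum_{i=1}^k\log\frac{X_{(i)}}{X_{(k)}},\quad k=1,\ldots,n$$ (defined arbitrarily when $k=0$ or $X_{(k)}=0$). *)

theory Defs
  imports "HOL-Probability.Probability" "HOL-Library.Landau_Symbols"
begin

definition regularly_varying :: "(real \<Rightarrow> real) \<Rightarrow> real \<Rightarrow> bool" where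
  "regularly_varying f \<rho> \<longleftrightarrow>
     f \<in> borel_measurable borel \<and>
     (\<forall>\<^sub>F x in at_top. 0 < f x) \<and>
     (\<forall>c>0. ((\<lambda>x. f (c * x) / f x) \<longlongrightarrow> c powr \<rho>) at_top)"

(* Sequences of random variables are indexed by 1, 2, ...; index 0 carries no assumption. *)
definition iid :: "'a measure \<Rightarrow> (nat \<Rightarrow> 'a \<Rightarrow> real) \<Rightarrow> bool" where
  "iid P Y \<longleftrightarrow>
     prob_space.indep_vars P (\<lambda>_. borel) Y {1..} \<and>
     (\<forall>j\<ge>1. distr P borel (Y j) = distr P borel (Y 1))"

(* Mutual independence of the two whole sequences, viewed as random elements of the
   product space, and not merely of H i and R j for each pair i, j. *)
definition indep_seqs :: "'a measure \<Rightarrow> (nat \<Rightarrow> 'a \<Rightarrow> real) \<Rightarrow> (nat \<Rightarrow> 'a \<Rightarrow> real) \<Rightarrow> bool" where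
  "indep_seqs P H R \<longleftrightarrow>
     prob_space.indep_var P
       (\<Pi>\<^sub>M j\<in>{1..}. borel) (\<lambda>\<omega>. \<lambda>j\<in>{1..}. H j \<omega>)
       (\<Pi>\<^sub>M j\<in>{1..}. borel) (\<lambda>\<omega>. \<lambda>j\<in>{1..}. R j \<omega>)"

definition trunc_sample ::
    "(nat \<Rightarrow> real) \<Rightarrow> (nat \<Rightarrow> 'a \<Rightarrow> real) \<Rightarrow> (nat \<Rightarrow> 'a \<Rightarrow> real) \<Rightarrow> nat \<Rightarrow> 'a \<Rightarrow> nat \<Rightarrow> real" where
  "trunc_sample M H R n \<omega> j =
     H j \<omega> * of_bool (H j \<omega> \<le> M n) + (M n + R j \<omega>) * of_bool (H j \<omega> > M n)"

(* The i-th largest of x 1, ..., x n, for 1 \<le> i \<le> n. *)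
definition order_stat :: "(nat \<Rightarrow> real) \<Rightarrow> nat \<Rightarrow> nat \<Rightarrow> real" where
  "order_stat x n i = rev (sort (map x [1..<Suc n])) ! (i - 1)"

(* In the cases where the statistic is defined arbitrarily, k = 0 or order_stat x n k = 0,
   totality of division and ln gives the value 0. *)
definition hill :: "(nat \<Rightarrow> real) \<Rightarrow> nat \<Rightarrow> nat \<Rightarrow> real" where
  "hill x n k = 1 / real k * (\<Sum>i=1..k. ln (order_stat x n i / order_stat x n k))"

(* For n \<ge> 1 and 0 < \<beta> the value is at most n, so it is a legitimate number of order
   statistics. *)
definition k_hat :: "real \<Rightarrow> real \<Rightarrow> (nat \<Rightarrow> real) \<Rightarrow> nat \<Rightarrow> nat" where
  "k_hat \<gamma> \<beta> x n =
     nat \<lfloor>real n * (1 / real n * (\<Sum>j=1..n. of_bool (x j > \<gamma> * Max (x ` {1..n})))) powr \<beta>\<rfloor>"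

(* Measurability is part of the notion: measure is 0 on non-measurable sets, so without it
   the limit below could hold for the wrong reason. *)
definition converges_in_prob :: "'a measure \<Rightarrow> (nat \<Rightarrow> 'a \<Rightarrow> real) \<Rightarrow> real \<Rightarrow> bool" where
  "converges_in_prob P Y c \<longleftrightarrow>
     (\<forall>n. Y n \<in> borel_measurable P) \<and>
     (\<forall>\<epsilon>>0. (\<lambda>n. measure P {\<omega> \<in> space P. \<bar>Y n \<omega> - c\<bar> > \<epsilon>}) \<longlonglongrightarrow> 0)"

end

theory Submission
  imports Defs
begin

text \<open>
  Write \<open>F x = P(H\<^sub>1 > x)\<close> and \<open>p\<^sub>n = F(M\<^sub>n)\<close>. Let \<open>N(t)\<close> be the number of sample points above \<open>t\<close> and \<open>L(t)\<close>
  the sum of the positive parts of \<open>log (X\<^sub>j / t)\<close>; then \<open>k\<close> times the Hill statistic is \<open>L\<close> at the \<open>k\<close>-th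
  largest sample point. The condition on the \<open>R\<^sub>j\<close> forces all sample points below \<open>(1 + \<epsilon>) M\<^sub>n\<close>, so the
  maximum is about \<open>M\<^sub>n\<close> and \<open>k\<close> is of the order of \<open>n p\<^sub>n\<^sup>\<beta>\<close>. Choose \<open>t\<^sub>n\<close> with \<open>F(t\<^sub>n)\<close> of the order of \<open>p\<^sub>n\<^sup>\<beta>\<close>.
  Then \<open>p\<^sub>n = o(F(t\<^sub>n))\<close>, so truncation is invisible at the scale \<open>t\<^sub>n\<close>, and Chebyshev's inequality shows
  that, after division by \<open>n F(t\<^sub>n)\<close>, \<open>N(s t\<^sub>n)\<close> and \<open>L(s t\<^sub>n)\<close> tend in probability to \<open>s powr -\<alpha>\<close> and
  \<open>s powr -\<alpha> / \<alpha>\<close> for every fixed \<open>s > 0\<close>. The \<open>k\<close>-th largest sample point is comparable to \<open>t\<^sub>n\<close>, hence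
  falls between two neighbours \<open>s t\<^sub>n\<close> and \<open>\<lambda> s t\<^sub>n\<close> of a finite geometric grid, and monotonicity of \<open>N\<close> and
  \<open>L\<close> puts the Hill statistic between \<open>L(\<lambda> s t\<^sub>n) / N(s t\<^sub>n)\<close> and \<open>L(s t\<^sub>n) / N(\<lambda> s t\<^sub>n)\<close>, which are close to
  \<open>\<lambda> powr -\<alpha> / \<alpha>\<close> and \<open>\<lambda> powr \<alpha> / \<alpha>\<close>; finally \<open>\<lambda> > 1\<close> is arbitrary.
\<close>

section \<open>Order statistics and the Hill statistic\<close>

definition tail_count :: "(nat \<Rightarrow> real) \<Rightarrow> nat \<Rightarrow> real \<Rightarrow> real" where
  "tail_count x n t = (\<Sum>j=1..n. of_bool (t < x j))"

text \<open>Taking the maximum before the logarithm makes the positive part 0 also at nonpositive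
  arguments, so each summand is antitone in \<open>t > 0\<close> whatever the sign of
  \<open>x j\<close>.\<close>

definition log_excess :: "(nat \<Rightarrow> real) \<Rightarrow> nat \<Rightarrow> real \<Rightarrow> real" where
  "log_excess x n t = (\<Sum>j=1..n. ln (max 1 (x j / t)))"

lemma tail_count_antimono: "s \<le> t \<Longrightarrow> tail_count x n t \<le> tail_count x n s"
  unfolding tail_count_def by (intro sum_mono) auto

lemma tail_count_nonneg: "0 \<le> tail_count x n t"
  unfolding tail_count_def by (intro sum_nonneg) auto

lemma tail_count_le: "tail_count x n t \<le> real n"
proof -
  have "tail_count x n t \<le> (\<Sum>j=1..n. 1)"
    unfolding tail_count_def by (intro sum_mono) auto
  then show ?thesis by simp
qed

lemma log_excess_antimono:
  assumes "0 < s" "s \<le> t"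
  shows "log_excess x n t \<le> log_excess x n s"
  unfolding log_excess_def
proof (intro sum_mono)
  fix j
  have "max 1 (x j / t) \<le> max 1 (x j / s)"
  \<comment> \<open>For negative \<open>x j\<close> the quotient grows with the threshold, but both
    quotients stay below the cutoff 1.\<close>
  proof (cases "0 \<le> x j")
    case True
    then have "x j / t \<le> x j / s" using assms by (intro divide_left_mono) auto
    then show ?thesis by auto
  next
    case False
    then have "x j / t \<le> 0" using assms by (simp add: divide_nonpos_pos)
    then show ?thesis by auto
  qed
  then show "ln (max 1 (x j / t)) \<le> ln (max 1 (x j / s))" by simp
qed

lemma order_stat_antimono:
  assumes "1 \<le> i" "i \<le> k" "k \<le> n"
  shows "order_stat x n k \<le> order_stat x n i"
proof -
  let ?L = "rev (sort (map x [1..<Suc n]))"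
  have "sorted_wrt (\<ge>) ?L" unfolding sorted_wrt_rev by simp
  then show ?thesis
    unfolding order_stat_def using assms
    by (cases "i = k") (auto simp del: upt_Suc intro!: sorted_wrt_nth_less[where P="(\<ge>)"])
qed

text \<open>Sorting permutes the sample, so symmetric sums such as \<open>tail_count\<close> and
  \<open>log_excess\<close> can be read off the sorted list.\<close>

lemma sum_order_stat: "(\<Sum>i=1..n. f (order_stat x n i)) = (\<Sum>j=1..n. f (x j :: real) :: real)"
proof -
  let ?L = "rev (sort (map x [1..<Suc n]))"
  have "(\<Sum>i=1..n. f (order_stat x n i)) = (\<Sum>i<n. f (?L ! i))"
    unfolding order_stat_def
    by (rule sum.reindex_bij_witness[of _ "\<lambda>i. i + 1" "\<lambda>i. i - 1"]) auto
  also have "\<dots> = sum_list (map f ?L)"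
    by (simp add: sum_list_sum_nth atLeast0LessThan del: upt_Suc)
  also have "\<dots> = sum_mset (mset (map f ?L))" by (simp only: sum_mset_sum_list)
  also have "mset (map f ?L) = mset (map f (map x [1..<Suc n]))"
    by (simp add: multiset.map_comp del: upt_Suc)
  also have "sum_mset \<dots> = sum_list (map f (map x [1..<Suc n]))" by (simp only: sum_mset_sum_list)
  also have "\<dots> = (\<Sum>j=1..n. f (x j))"
    by (simp add: comp_def interv_sum_list_conv_sum_set_nat atLeastLessThanSuc_atLeastAtMost del: upt_Suc)
  finally show ?thesis .
qed

text \<open>The points above \<open>t\<close> come first in the decreasing list. This turns
  questions about the random threshold \<open>order_stat x n k\<close> into questions about counts
  at fixed levels.\<close>

lemma less_order_stat_iff:
  assumes "1 \<le> k" "k \<le> n"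
  shows "t < order_stat x n k \<longleftrightarrow> real k \<le> tail_count x n t"
proof -
  have eq: "tail_count x n t = (\<Sum>i=1..n. of_bool (t < order_stat x n i))"
    unfolding tail_count_def by (rule sum_order_stat[symmetric])
  show ?thesis
  proof
    assume t: "t < order_stat x n k"
    have "(\<Sum>i=1..k. of_bool (t < order_stat x n i)) = (\<Sum>i=1..k. 1 :: real)"
    proof (rule sum.cong)
      fix i assume "i \<in> {1..k}"
      then show "of_bool (t < order_stat x n i) = (1 :: real)"
        using order_stat_antimono[of i k n x] t assms by auto
    qed simp
    moreover have "(\<Sum>i=1..k. of_bool (t < order_stat x n i)) \<le> tail_count x n t"
      unfolding eq using assms by (intro sum_mono2) auto
    ultimately show "real k \<le> tail_count x n t" by simp
  next
    assume k: "real k \<le> tail_count x n t"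
    show "t < order_stat x n k"
    proof (rule ccontr)
      assume t: "\<not> t < order_stat x n k"
      \<comment> \<open>If the \<open>k\<close>-th entry is at most \<open>t\<close>, then only the
        \<open>k - 1\<close> entries before it can exceed \<open>t\<close>.\<close>
      have "tail_count x n t = (\<Sum>i=1..k-1. of_bool (t < order_stat x n i))"
        unfolding eq
      proof (rule sum.mono_neutral_right)
        show "\<forall>i\<in>{1..n} - {1..k - 1}. of_bool (t < order_stat x n i) = (0::real)"
        proof
          fix i assume "i \<in> {1..n} - {1..k - 1}"
          then have "order_stat x n i \<le> order_stat x n k"
            using assms by (intro order_stat_antimono) auto
          then show "of_bool (t < order_stat x n i) = (0::real)" using t by simp
        qed
      qed (use assms in auto)
      also have "\<dots> \<le> (\<Sum>i=1..k-1. 1)" by (intro sum_mono) auto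
      finally show False using k assms by simp
    qed
  qed
qed

text \<open>Entries after the \<open>k\<close>-th do not exceed the threshold and have positive part
  0; for the first \<open>k\<close> entries the cutoff at 1 is inactive.\<close>

lemma hill_eq_log_excess:
  assumes "1 \<le> k" "k \<le> n" "0 < order_stat x n k"
  shows "hill x n k = log_excess x n (order_stat x n k) / real k"
proof -
  let ?o = "order_stat x n"
  have "log_excess x n (?o k) = (\<Sum>i=1..n. ln (max 1 (?o i / ?o k)))"
    unfolding log_excess_def by (rule sum_order_stat[symmetric])
  also have "\<dots> = (\<Sum>i=1..k. ln (max 1 (?o i / ?o k)))"
  proof (rule sum.mono_neutral_right)
    show "\<forall>i\<in>{1..n} - {1..k}. ln (max 1 (?o i / ?o k)) = 0"
    proof
      fix i assume "i \<in> {1..n} - {1..k}"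
      then have "?o i \<le> ?o k" using assms by (intro order_stat_antimono) auto
      then have "?o i / ?o k \<le> 1" using assms by simp
      then show "ln (max 1 (?o i / ?o k)) = 0" by (simp add: max_absorb1)
    qed
  qed (use assms in auto)
  also have "\<dots> = (\<Sum>i=1..k. ln (?o i / ?o k))"
  proof (rule sum.cong)
    fix i assume "i \<in> {1..k}"
    then have "1 \<le> ?o i / ?o k" using order_stat_antimono[of i k n x] assms by simp
    then show "ln (max 1 (?o i / ?o k)) = ln (?o i / ?o k)" by (simp add: max_absorb2)
  qed simp
  finally show ?thesis unfolding hill_def by simp
qed

text \<open>The two counts locate the \<open>k\<close>-th order statistic between \<open>s\<close>
  and \<open>t\<close>, and the log-excess is antitone in its threshold.\<close>

lemma hill_between:
  assumes "1 \<le> k" "k \<le> n" "0 < s" "s \<le> t" "real k \<le> tail_count x n s" "tail_count x n t < real k"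
  shows "log_excess x n t / real k \<le> hill x n k" "hill x n k \<le> log_excess x n s / real k"
proof -
  have s: "s < order_stat x n k" and t: "order_stat x n k \<le> t"
    using assms less_order_stat_iff[of k n _ x] by (auto simp: not_less[symmetric])
  have "hill x n k = log_excess x n (order_stat x n k) / real k"
    using assms s by (intro hill_eq_log_excess) auto
  then show "log_excess x n t / real k \<le> hill x n k" "hill x n k \<le> log_excess x n s / real k"
    using s t assms by (auto intro!: divide_right_mono log_excess_antimono)
qed

lemma k_hat_eq: "k_hat \<gamma> \<beta> x n =
    nat \<lfloor>real n * (tail_count x n (\<gamma> * Max (x ` {1..n})) / real n) powr \<beta>\<rfloor>"
  unfolding k_hat_def tail_count_def by simp

lemma k_hat_le:
  assumes "0 < \<beta>"
  shows "k_hat \<gamma> \<beta> x n \<le> n"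
proof -
  let ?q = "tail_count x n (\<gamma> * Max (x ` {1..n})) / real n"
  have "?q \<le> 1" "0 \<le> ?q" 
    using tail_count_le[of x n] tail_count_nonneg[of x n] by (auto simp: divide_le_eq_1)
  then have "?q powr \<beta> \<le> 1" using assms by (intro powr_le1) auto
  then have "real n * ?q powr \<beta> \<le> real n" by (simp add: mult_left_le)
  then show ?thesis unfolding k_hat_eq by linarith
qed

section \<open>Measurability of counts, order statistics and the Hill statistic\<close>

lemma borel_measurable_tail_count:
  assumes x: "\<And>j. 1 \<le> j \<Longrightarrow> j \<le> n \<Longrightarrow> (\<lambda>\<omega>. x \<omega> j) \<in> borel_measurable N"
    and t: "t \<in> borel_measurable N"
  shows "(\<lambda>\<omega>. tail_count (x \<omega>) n (t \<omega>)) \<in> borel_measurable N"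
  unfolding tail_count_def
proof (intro borel_measurable_sum)
  fix j assume "j \<in> {1..n}"
  then have [measurable]: "(\<lambda>\<omega>. x \<omega> j) \<in> borel_measurable N" using x by auto
  note t[measurable]
  show "(\<lambda>\<omega>. of_bool (t \<omega> < x \<omega> j) :: real) \<in> borel_measurable N" by measurable
qed

lemma borel_measurable_order_stat:
  assumes x: "\<And>j. 1 \<le> j \<Longrightarrow> j \<le> n \<Longrightarrow> (\<lambda>\<omega>. x \<omega> j) \<in> borel_measurable N"
    and k: "1 \<le> k" "k \<le> n"
  shows "(\<lambda>\<omega>. order_stat (x \<omega>) n k) \<in> borel_measurable N"
proof (rule borel_measurableI_greater)
  fix t
  have "(\<lambda>\<omega>. tail_count (x \<omega>) n t) \<in> borel_measurable N"
    by (rule borel_measurable_tail_count[OF x]) auto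
  then have "{\<omega> \<in> space N. real k \<le> tail_count (x \<omega>) n t} \<in> sets N" by measurable
  then show "{\<omega> \<in> space N. t < order_stat (x \<omega>) n k} \<in> sets N"
    using less_order_stat_iff[OF k] by simp
qed

text \<open>The random index takes countably many values, so it suffices to treat each fixed index
  and compose.\<close>

lemma borel_measurable_hill_k_hat:
  assumes x: "\<And>j. 1 \<le> j \<Longrightarrow> j \<le> n \<Longrightarrow> (\<lambda>\<omega>. x \<omega> j) \<in> borel_measurable N" and "0 < \<beta>"
  shows "(\<lambda>\<omega>. hill (x \<omega>) n (k_hat \<gamma> \<beta> (x \<omega>) n)) \<in> borel_measurable N"
proof -
  have Max: "(\<lambda>\<omega>. Max ((\<lambda>j. x \<omega> j) ` {1..n})) \<in> borel_measurable N"
    by (rule borel_measurable_Max[where f="\<lambda>j \<omega>. x \<omega> j"]) (use x in auto)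
  have "(\<lambda>\<omega>. tail_count (x \<omega>) n (\<gamma> * Max (x \<omega> ` {1..n}))) \<in> borel_measurable N"
    by (intro borel_measurable_tail_count borel_measurable_times borel_measurable_const Max x)
  then have k: "(\<lambda>\<omega>. k_hat \<gamma> \<beta> (x \<omega>) n) \<in> measurable N (count_space UNIV)"
    unfolding k_hat_eq by measurable
  \<comment> \<open>Order statistics make sense only up to index \<open>n\<close>; capping the index
    there changes nothing at \<open>k_hat\<close>, which never exceeds \<open>n\<close>.\<close>
  have "(\<lambda>\<omega>. hill (x \<omega>) n (min k n)) \<in> borel_measurable N" for k
  proof (cases "min k n = 0")
    case True
    show ?thesis unfolding hill_def True by simp
  next
    case False
    show ?thesis unfolding hill_def
      by (intro borel_measurable_times borel_measurable_const borel_measurable_sum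
          borel_measurable_ln borel_measurable_divide borel_measurable_order_stat x)
        (use False in auto)
  qed
  then have "(\<lambda>\<omega>. hill (x \<omega>) n (min (k_hat \<gamma> \<beta> (x \<omega>) n) n)) \<in> borel_measurable N"
    by (rule measurable_compose_countable[OF _ k])
  moreover have "min (k_hat \<gamma> \<beta> (x \<omega>) n) n = k_hat \<gamma> \<beta> (x \<omega>) n" for \<omega>
    using k_hat_le[OF \<open>0 < \<beta>\<close>] by (simp add: min_absorb1)
  ultimately show ?thesis by simp
qed

section \<open>Convergence in probability as a filter limit\<close>

text \<open>
  The filter of events whose probability tends to 1, so that convergence in probability becomes \<open>tendsto\<close>
  along it; events need not be measurable, only contain measurable ones.
\<close>

definition whp :: "'a measure \<Rightarrow> (nat \<times> 'a) filter" where
  "whp P = Abs_filter (\<lambda>Q. \<exists>A. (\<forall>n. A n \<in> sets P) \<and> (\<lambda>n. measure P (A n)) \<longlonglongrightarrow> 1 \<and>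
     (\<forall>n. \<forall>\<omega>\<in>A n. Q (n, \<omega>)))"

lemma (in prob_space) prob_tendsto_1_iff:
  assumes "\<And>n. A n \<in> events"
  shows "(\<lambda>n. prob (space M - A n)) \<longlonglongrightarrow> 0 \<longleftrightarrow> (\<lambda>n. prob (A n)) \<longlonglongrightarrow> 1"
proof
  assume "(\<lambda>n. prob (space M - A n)) \<longlonglongrightarrow> 0"
  then have "(\<lambda>n. 1 - prob (space M - A n)) \<longlonglongrightarrow> 1 - 0" by (intro tendsto_intros)
  then show "(\<lambda>n. prob (A n)) \<longlonglongrightarrow> 1" using assms by (simp add: prob_compl)
next
  assume "(\<lambda>n. prob (A n)) \<longlonglongrightarrow> 1"
  then have "(\<lambda>n. 1 - prob (A n)) \<longlonglongrightarrow> 1 - 1" by (intro tendsto_intros)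
  then show "(\<lambda>n. prob (space M - A n)) \<longlonglongrightarrow> 0" using assms by (simp add: prob_compl)
qed

text \<open>The filter laws have to be checked before the definition can be unfolded. The law with
  content is closure under conjunction, which is the union bound applied to the complements of the
  two witnesses.\<close>

lemma (in prob_space) eventually_whp:
  "eventually Q (whp M) \<longleftrightarrow> (\<exists>A. (\<forall>n. A n \<in> events) \<and> (\<lambda>n. prob (A n)) \<longlonglongrightarrow> 1 \<and>
     (\<forall>n. \<forall>\<omega>\<in>A n. Q (n, \<omega>)))"
  unfolding whp_def
proof (rule eventually_Abs_filter, rule is_filter.intro)
  show "\<exists>A. (\<forall>n. A n \<in> events) \<and> (\<lambda>n. prob (A n)) \<longlonglongrightarrow> 1 \<and> (\<forall>n. \<forall>\<omega>\<in>A n. True)"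
    by (intro exI[of _ "\<lambda>_. space M"]) (simp add: prob_space)
next
  fix Q1 Q2 :: "nat \<times> 'a \<Rightarrow> bool"
  assume "\<exists>A. (\<forall>n. A n \<in> events) \<and> (\<lambda>n. prob (A n)) \<longlonglongrightarrow> 1 \<and> (\<forall>n. \<forall>\<omega>\<in>A n. Q1 (n, \<omega>))"
    and "\<exists>A. (\<forall>n. A n \<in> events) \<and> (\<lambda>n. prob (A n)) \<longlonglongrightarrow> 1 \<and> (\<forall>n. \<forall>\<omega>\<in>A n. Q2 (n, \<omega>))"
  then obtain A B where
    A: "\<And>n. A n \<in> events" "(\<lambda>n. prob (A n)) \<longlonglongrightarrow> 1" "\<And>n \<omega>. \<omega> \<in> A n \<Longrightarrow> Q1 (n, \<omega>)" and
    B: "\<And>n. B n \<in> events" "(\<lambda>n. prob (B n)) \<longlonglongrightarrow> 1" "\<And>n \<omega>. \<omega> \<in> B n \<Longrightarrow> Q2 (n, \<omega>)"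
    by metis
  have "(\<lambda>n. prob (space M - (A n \<inter> B n))) \<longlonglongrightarrow> 0"
  proof (rule tendsto_sandwich[OF always_eventually _ tendsto_const])
    have "(\<lambda>n. prob (space M - A n) + prob (space M - B n)) \<longlonglongrightarrow> 0 + 0"
      using A B by (intro tendsto_add) (simp_all add: prob_tendsto_1_iff)
    then show "(\<lambda>n. prob (space M - A n) + prob (space M - B n)) \<longlonglongrightarrow> 0" by simp
    show "\<forall>\<^sub>F n in sequentially.
        prob (space M - (A n \<inter> B n)) \<le> prob (space M - A n) + prob (space M - B n)"
    proof (intro always_eventually allI)
      fix n
      have "prob ((space M - A n) \<union> (space M - B n))
          \<le> prob (space M - A n) + prob (space M - B n)"
        using A B by (intro measure_Un_le) auto
      then show "prob (space M - (A n \<inter> B n)) \<le> prob (space M - A n) + prob (space M - B n)"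
        by (simp add: Diff_Int)
    qed
  qed simp
  then have "(\<lambda>n. prob (A n \<inter> B n)) \<longlonglongrightarrow> 1"
    using A B prob_tendsto_1_iff[of "\<lambda>n. A n \<inter> B n"] by auto
  then show "\<exists>A. (\<forall>n. A n \<in> events) \<and> (\<lambda>n. prob (A n)) \<longlonglongrightarrow> 1 \<and>
      (\<forall>n. \<forall>\<omega>\<in>A n. Q1 (n, \<omega>) \<and> Q2 (n, \<omega>))"
    using A B by (intro exI[of _ "\<lambda>n. A n \<inter> B n"]) auto
next
  fix Q1 Q2 :: "nat \<times> 'a \<Rightarrow> bool"
  assume "\<forall>x. Q1 x \<longrightarrow> Q2 x"
    and "\<exists>A. (\<forall>n. A n \<in> events) \<and> (\<lambda>n. prob (A n)) \<longlonglongrightarrow> 1 \<and> (\<forall>n. \<forall>\<omega>\<in>A n. Q1 (n, \<omega>))"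
  then show "\<exists>A. (\<forall>n. A n \<in> events) \<and> (\<lambda>n. prob (A n)) \<longlonglongrightarrow> 1 \<and> (\<forall>n. \<forall>\<omega>\<in>A n. Q2 (n, \<omega>))"
    by blast
qed

lemma (in prob_space) eventually_whpI:
  assumes "\<And>n. B n \<in> events" "(\<lambda>n. prob (B n)) \<longlonglongrightarrow> 0"
    and "\<And>n \<omega>. \<omega> \<in> space M \<Longrightarrow> \<omega> \<notin> B n \<Longrightarrow> Q (n, \<omega>)"
  shows "eventually Q (whp M)"
  unfolding eventually_whp
proof (intro exI[of _ "\<lambda>n. space M - B n"] conjI allI ballI)
  have "space M - (space M - B n) = B n" for n
    using sets.sets_into_space[OF assms(1)] by auto
  then show "(\<lambda>n. prob (space M - B n)) \<longlonglongrightarrow> 1"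
    using assms prob_tendsto_1_iff[of "\<lambda>n. space M - B n"] by auto
qed (use assms in auto)

text \<open>An event that depends on \<open>n\<close> alone has probability 0 or 1, so ordinary
  limits in \<open>n\<close> are limits along \<open>whp M\<close>; the exceptional set is the whole
  space where the property fails.\<close>

lemma (in prob_space) filterlim_fst_whp: "filterlim fst sequentially (whp M)"
  unfolding filterlim_iff
proof (intro allI impI)
  fix Q :: "nat \<Rightarrow> bool" assume Q: "eventually Q sequentially"
  show "\<forall>\<^sub>F z in whp M. Q (fst z)"
  proof (rule eventually_whpI[where B="\<lambda>n. if Q n then {} else space M"])
    have "\<forall>\<^sub>F n in sequentially. prob (if Q n then {} else space M) = 0"
      using Q by eventually_elim simp
    then show "(\<lambda>n. prob (if Q n then {} else space M)) \<longlonglongrightarrow> 0"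
      by (rule tendsto_eventually)
  qed (auto split: if_splits)
qed

lemma (in prob_space) eventually_whp_fst: "eventually Q sequentially \<Longrightarrow> \<forall>\<^sub>F z in whp M. Q (fst z)"
  using filterlim_fst_whp unfolding filterlim_iff by blast

lemma (in prob_space) tendsto_whp_fst: "filterlim f F sequentially \<Longrightarrow> filterlim (\<lambda>z. f (fst z)) F (whp M)"
  by (rule filterlim_compose[OF _ filterlim_fst_whp])

lemma (in prob_space) AE_imp_eventually_whp:
  assumes "AE \<omega> in M. Q \<omega>"
  shows "\<forall>\<^sub>F z in whp M. Q (snd z)"
proof -
  from assms obtain N where N: "{\<omega> \<in> space M. \<not> Q \<omega>} \<subseteq> N" "emeasure M N = 0" "N \<in> events"
    by (rule AE_E)
  show ?thesis
    by (rule eventually_whpI[where B="\<lambda>_. N"]) (use N in \<open>auto simp: measure_def\<close>)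
qed

text \<open>Closeness along the filter comes with measurable witnesses \<open>A n\<close>, and the
  deviation event lies in the complement of \<open>A n\<close>.\<close>

lemma (in prob_space) converges_in_prob_if_tendsto_whp:
  assumes Y: "\<And>n. Y n \<in> borel_measurable M"
    and lim: "((\<lambda>z. Y (fst z) (snd z)) \<longlongrightarrow> c) (whp M)"
  shows "converges_in_prob M Y c"
  unfolding converges_in_prob_def
proof (intro conjI allI impI Y)
  fix \<epsilon> :: real assume "0 < \<epsilon>"
  have [measurable]: "Y n \<in> borel_measurable M" for n by (rule Y)
  from tendstoD[OF lim \<open>0 < \<epsilon>\<close>] obtain A where
    A: "\<And>n. A n \<in> events" "(\<lambda>n. prob (A n)) \<longlonglongrightarrow> 1"
      "\<And>n \<omega>. \<omega> \<in> A n \<Longrightarrow> \<bar>Y n \<omega> - c\<bar> < \<epsilon>"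
    unfolding eventually_whp by (auto simp: dist_real_def)
  show "(\<lambda>n. prob {\<omega> \<in> space M. \<epsilon> < \<bar>Y n \<omega> - c\<bar>}) \<longlonglongrightarrow> 0"
  proof (rule tendsto_sandwich[OF always_eventually _ tendsto_const])
    show "(\<lambda>n. prob (space M - A n)) \<longlonglongrightarrow> 0" using A by (simp add: prob_tendsto_1_iff)
    show "\<forall>\<^sub>F n in sequentially. prob {\<omega> \<in> space M. \<epsilon> < \<bar>Y n \<omega> - c\<bar>} \<le> prob (space M - A n)"
      using A by (intro always_eventually allI finite_measure_mono) (auto dest: less_asym)
  qed simp
qed

section \<open>A weak law for triangular arrays\<close>

text \<open>Induction on the index set: the cross term factors by independence and vanishes because
  the means are 0. Integrability is carried along to justify expanding the square.\<close>

lemma (in prob_space) second_moment_sum_indep: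
  fixes Z :: "'i \<Rightarrow> 'a \<Rightarrow> real"
  assumes "finite I" "indep_vars (\<lambda>_. borel) Z I"
    and "\<And>i. i \<in> I \<Longrightarrow> integrable M (\<lambda>\<omega>. (Z i \<omega>)\<^sup>2)"
    and "\<And>i. i \<in> I \<Longrightarrow> expectation (Z i) = 0"
  shows "integrable M (\<lambda>\<omega>. (\<Sum>i\<in>I. Z i \<omega>)\<^sup>2) \<and>
    expectation (\<lambda>\<omega>. (\<Sum>i\<in>I. Z i \<omega>)\<^sup>2) = (\<Sum>i\<in>I. expectation (\<lambda>\<omega>. (Z i \<omega>)\<^sup>2))"
  using assms
proof (induction I rule: finite_induct)
  case (insert i I)
  let ?S = "\<lambda>\<omega>. \<Sum>i\<in>I. Z i \<omega>"
  have ind: "indep_vars (\<lambda>_. borel) Z I"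
    using insert.prems(1) by (rule indep_vars_subset) auto
  have IH: "integrable M (\<lambda>\<omega>. (?S \<omega>)\<^sup>2)"
    "expectation (\<lambda>\<omega>. (?S \<omega>)\<^sup>2) = (\<Sum>i\<in>I. expectation (\<lambda>\<omega>. (Z i \<omega>)\<^sup>2))"
    using insert.IH[OF ind] insert.prems by auto
  have rv: "\<And>j. j \<in> insert i I \<Longrightarrow> random_variable borel (Z j)"
    using insert.prems(1) unfolding indep_vars_def by auto
  have int: "integrable M (Z j)" if "j \<in> insert i I" for j
    by (rule square_integrable_imp_integrable[OF rv[OF that] insert.prems(2)[OF that]])
  have intS: "integrable M ?S" by (intro Bochner_Integration.integrable_sum int) simp
  have indep: "indep_var borel (Z i) borel ?S"
    using insert.hyps insert.prems(1) by (intro indep_vars_sum) auto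
  have prod: "integrable M (\<lambda>\<omega>. Z i \<omega> * ?S \<omega>)" "expectation (\<lambda>\<omega>. Z i \<omega> * ?S \<omega>) = 0"
    using indep_var_integrable[OF indep int intS] indep_var_lebesgue_integral[OF indep int intS]
      insert.prems(3)[of i] by auto
  have eq: "(\<Sum>j\<in>insert i I. Z j \<omega>)\<^sup>2 = (Z i \<omega>)\<^sup>2 + (?S \<omega>)\<^sup>2 + 2 * (Z i \<omega> * ?S \<omega>)" for \<omega>
    using insert.hyps by (simp add: power2_sum)
  show ?case
    unfolding eq using insert.hyps insert.prems IH prod by simp
qed simp

text \<open>Chebyshev's inequality for the centred sum: its variance is at most \<open>n\<close>
  times the second moment of \<open>g n (H 1)\<close>, and dividing by the square of
  \<open>n * a n\<close> leaves the quantity in \<open>var\<close>. The function \<open>g n\<close>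
  and the normalisation \<open>a n\<close> may both vary with \<open>n\<close>.\<close>

lemma (in prob_space) weak_law_triangular:
  fixes H :: "nat \<Rightarrow> 'a \<Rightarrow> real" and g :: "nat \<Rightarrow> real \<Rightarrow> real"
  assumes iid: "iid M H"
    and g: "\<And>n. g n \<in> borel_measurable borel"
    and int: "\<forall>\<^sub>F n in sequentially. integrable M (\<lambda>\<omega>. (g n (H 1 \<omega>))\<^sup>2)"
    and a: "\<forall>\<^sub>F n in sequentially. 0 < a n"
    and mean: "(\<lambda>n. expectation (\<lambda>\<omega>. g n (H 1 \<omega>)) / a n) \<longlonglongrightarrow> c"
    and var: "(\<lambda>n. expectation (\<lambda>\<omega>. (g n (H 1 \<omega>))\<^sup>2) / (real n * (a n)\<^sup>2)) \<longlonglongrightarrow> 0"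
  shows "((\<lambda>z. (\<Sum>j=1..fst z. g (fst z) (H j (snd z))) / (real (fst z) * a (fst z))) \<longlongrightarrow> c) (whp M)"
proof (rule tendstoI)
  fix e :: real assume e: "0 < e"
  note g[measurable]
  have ind: "indep_vars (\<lambda>_. borel) H {1..}"
    and dist: "\<And>j. 1 \<le> j \<Longrightarrow> distr M borel (H j) = distr M borel (H 1)"
    using iid unfolding iid_def by blast+
  have H[measurable]: "random_variable borel (H j)" if "j \<in> {1..}" for j
    using ind that unfolding indep_vars_def by auto
  define m where "m n = expectation (\<lambda>\<omega>. g n (H 1 \<omega>))" for n
  define v where "v n = expectation (\<lambda>\<omega>. (g n (H 1 \<omega>))\<^sup>2)" for n
  define Z where "Z n j \<omega> = g n (H j \<omega>) - m n" for n j \<omega>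
  define S where "S n \<omega> = (\<Sum>j=1..n. Z n j \<omega>)" for n \<omega>
  have Zm: "Z n j \<in> borel_measurable M" if "j \<in> {1..}" for n j
    unfolding Z_def using H[OF that] by measurable
  have Sm[measurable]: "S n \<in> borel_measurable M" for n
    unfolding S_def by (intro borel_measurable_sum Zm) auto
  \<comment> \<open>The deviation event, emptied at the indices where the eventual hypotheses do not
    hold yet. Half of \<open>e\<close> is spent here, the other half on the convergence of the
    means.\<close>
  define B where "B n = (if 0 < a n \<and> 1 \<le> n \<and> integrable M (\<lambda>\<omega>. (g n (H 1 \<omega>))\<^sup>2)
    then {\<omega> \<in> space M. real n * a n * (e / 2) \<le> \<bar>S n \<omega>\<bar>} else {})" for n
  have B: "B n \<in> events" for n unfolding B_def by simp
  have bound: "prob (B n) \<le> v n / (real n * (a n)\<^sup>2) * (4 / e\<^sup>2)"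
    if "0 < a n" "1 \<le> n" "integrable M (\<lambda>\<omega>. (g n (H 1 \<omega>))\<^sup>2)" for n
  proof -
    have [measurable]: "random_variable borel (H 1)" by (rule H) simp
    have int1: "integrable M (\<lambda>\<omega>. g n (H 1 \<omega>))"
      by (rule square_integrable_imp_integrable[OF _ that(3)]) measurable
    have Z1: "integrable M (\<lambda>\<omega>. (Z n 1 \<omega>)\<^sup>2)" "expectation (Z n 1) = 0"
      "expectation (\<lambda>\<omega>. (Z n 1 \<omega>)\<^sup>2) \<le> v n"
    proof -
      show "integrable M (\<lambda>\<omega>. (Z n 1 \<omega>)\<^sup>2)"
        unfolding Z_def power2_diff using int1 that by simp
      show "expectation (Z n 1) = 0"
        unfolding Z_def[abs_def] using int1 by (simp add: m_def prob_space)
      have "expectation (\<lambda>\<omega>. (Z n 1 \<omega>)\<^sup>2) = v n - (m n)\<^sup>2"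
        unfolding Z_def m_def v_def using int1 that by (intro variance_eq) auto
      then show "expectation (\<lambda>\<omega>. (Z n 1 \<omega>)\<^sup>2) \<le> v n" by simp
    qed
    \<comment> \<open>Equality of distributions carries every moment from \<open>H 1\<close> over to
      \<open>H j\<close>.\<close>
    have same: "integrable M (\<lambda>\<omega>. f (H j \<omega>)) \<longleftrightarrow> integrable M (\<lambda>\<omega>. f (H 1 \<omega>))"
      "expectation (\<lambda>\<omega>. f (H j \<omega>)) = expectation (\<lambda>\<omega>. f (H 1 \<omega>))"
      if "1 \<le> j" and [measurable]: "f \<in> borel_measurable borel" for j and f :: "real \<Rightarrow> real"
    proof -
      have [measurable]: "random_variable borel (H j)" by (rule H) (use that in simp)
      have "integrable M (\<lambda>\<omega>. f (H j \<omega>)) \<longleftrightarrow> integrable (distr M borel (H j)) f"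
        by (subst integrable_distr_eq) auto
      also have "\<dots> \<longleftrightarrow> integrable (distr M borel (H 1)) f" using dist[OF that(1)] by simp
      also have "\<dots> \<longleftrightarrow> integrable M (\<lambda>\<omega>. f (H 1 \<omega>))" by (subst integrable_distr_eq) auto
      finally show "integrable M (\<lambda>\<omega>. f (H j \<omega>)) \<longleftrightarrow> integrable M (\<lambda>\<omega>. f (H 1 \<omega>))" .
      have "expectation (\<lambda>\<omega>. f (H j \<omega>)) = integral\<^sup>L (distr M borel (H j)) f"
        by (subst integral_distr) auto
      also have "\<dots> = integral\<^sup>L (distr M borel (H 1)) f" using dist[OF that(1)] by simp
      also have "\<dots> = expectation (\<lambda>\<omega>. f (H 1 \<omega>))" by (subst integral_distr) auto
      finally show "expectation (\<lambda>\<omega>. f (H j \<omega>)) = expectation (\<lambda>\<omega>. f (H 1 \<omega>))" .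
    qed
    have Zj: "integrable M (\<lambda>\<omega>. (Z n j \<omega>)\<^sup>2)" "expectation (Z n j) = 0"
      "expectation (\<lambda>\<omega>. (Z n j \<omega>)\<^sup>2) \<le> v n" if "1 \<le> j" for j
      using Z1 same[OF that, of "\<lambda>x. g n x - m n"] same[OF that, of "\<lambda>x. (g n x - m n)\<^sup>2"]
      unfolding Z_def[abs_def] by auto
    have indZ: "indep_vars (\<lambda>_. borel) (Z n) {1..n}"
      unfolding Z_def[abs_def]
      by (rule indep_vars_compose2[where Y="\<lambda>j x. g n x - m n"]) (auto intro: indep_vars_subset[OF ind])
    have S2: "integrable M (\<lambda>\<omega>. (S n \<omega>)\<^sup>2)"
      "expectation (\<lambda>\<omega>. (S n \<omega>)\<^sup>2) = (\<Sum>j=1..n. expectation (\<lambda>\<omega>. (Z n j \<omega>)\<^sup>2))"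
      unfolding S_def using second_moment_sum_indep[OF _ indZ] Zj by auto
    have "(\<Sum>j=1..n. expectation (\<lambda>\<omega>. (Z n j \<omega>)\<^sup>2)) \<le> (\<Sum>j=1..n. v n)"
      using Zj by (intro sum_mono) auto
    then have S2': "expectation (\<lambda>\<omega>. (S n \<omega>)\<^sup>2) \<le> real n * v n" using S2 by simp
    let ?r = "real n * a n * (e / 2)"
    have r: "0 < ?r" using that e by simp
    have "prob (B n) = prob {\<omega> \<in> space M. ?r \<le> \<bar>S n \<omega>\<bar>}" unfolding B_def using that by simp
    also have "\<dots> \<le> expectation (\<lambda>\<omega>. (S n \<omega>)\<^sup>2) / ?r\<^sup>2"
      by (rule second_moment_method) (use S2 r in auto)
    also have "\<dots> \<le> real n * v n / ?r\<^sup>2"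
      using S2' by (intro divide_right_mono) auto
    also have "\<dots> = v n / (real n * (a n)\<^sup>2) * (4 / e\<^sup>2)"
      using that e by (simp add: power2_eq_square field_simps)
    finally show ?thesis .
  qed
  have "\<forall>\<^sub>F z in whp M. snd z \<in> space M \<and> snd z \<notin> B (fst z)"
  proof (rule eventually_whpI[OF B])
    show "(\<lambda>n. prob (B n)) \<longlonglongrightarrow> 0"
    proof (rule tendsto_sandwich[OF always_eventually _ tendsto_const])
      show "\<forall>\<^sub>F n in sequentially. prob (B n) \<le> v n / (real n * (a n)\<^sup>2) * (4 / e\<^sup>2)"
        using int a eventually_ge_at_top[of 1] by eventually_elim (rule bound)
      show "(\<lambda>n. v n / (real n * (a n)\<^sup>2) * (4 / e\<^sup>2)) \<longlonglongrightarrow> 0"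
        using tendsto_mult_right[OF var, of "4 / e\<^sup>2"] by (simp add: v_def)
    qed simp
  qed auto
  moreover have "\<forall>\<^sub>F z in whp M. \<bar>m (fst z) / a (fst z) - c\<bar> < e / 2"
    using eventually_whp_fst[OF tendstoD[OF mean, of "e / 2"]] e
    by (simp add: m_def dist_real_def)
  ultimately show "\<forall>\<^sub>F z in whp M.
      dist ((\<Sum>j=1..fst z. g (fst z) (H j (snd z))) / (real (fst z) * a (fst z))) c < e"
    using eventually_whp_fst[OF int] eventually_whp_fst[OF a]
      eventually_whp_fst[OF eventually_ge_at_top[of 1]]
  proof eventually_elim
    case (elim z)
    obtain n \<omega> where z: "z = (n, \<omega>)" by (cases z)
    let ?q = "(\<Sum>j=1..n. g n (H j \<omega>)) / (real n * a n)"
    have a0: "0 < a n" and na: "0 < real n * a n" using elim z by simp_all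
    have "\<bar>S n \<omega>\<bar> < real n * a n * (e / 2)" using elim z by (auto simp: B_def)
    then have "\<bar>S n \<omega> / (real n * a n)\<bar> < e / 2" using na a0 by (simp add: field_simps abs_mult)
    moreover have "S n \<omega> / (real n * a n) = ?q - m n / a n"
      using na elim z by (simp add: S_def Z_def sum_subtractf field_simps)
    ultimately have "dist ?q (m n / a n) < e / 2" by (simp add: dist_real_def)
    moreover have "dist c (m n / a n) < e / 2"
      using elim z by (simp add: dist_real_def abs_minus_commute)
    ultimately have "dist ?q c < e" by (rule dist_triangle_half_l)
    then show ?case by (simp add: z)
  qed
qed

section \<open>Regularly varying tails\<close>

lemma regularly_varying_tendsto:
  "regularly_varying F \<rho> \<Longrightarrow> 0 < c \<Longrightarrow> ((\<lambda>x. F (c * x) / F x) \<longlongrightarrow> c powr \<rho>) at_top"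
  unfolding regularly_varying_def by blast

text \<open>A Potter bound, which will serve as dominating function. Far out, multiplying the
  argument by \<open>exp 1\<close> costs at least the factor \<open>exp (- \<alpha> / 2)\<close>,
  because the limiting factor \<open>exp (- \<alpha>)\<close> is strictly smaller. Iteration treats
  integer exponents and monotonicity the rest.\<close>

lemma regularly_varying_potter:
  assumes rv: "regularly_varying F (- \<alpha>)" and F: "antimono F" and \<alpha>: "0 < \<alpha>"
  shows "\<exists>T>0. \<forall>t\<ge>T. 0 < F t \<and> (\<forall>u\<ge>0. F (t * exp u) \<le> exp (\<alpha> / 2) * exp (- (\<alpha> / 2) * u) * F t)"
proof -
  have "exp 1 powr (- \<alpha>) < exp (- \<alpha> / 2)" using \<alpha> by (simp add: powr_def)
  then have "\<forall>\<^sub>F t in at_top. F (exp 1 * t) / F t < exp (- \<alpha> / 2)"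
    by (intro order_tendstoD(2)[OF regularly_varying_tendsto[OF rv]]) auto
  moreover have "\<forall>\<^sub>F t in at_top. 0 < F t" using rv by (simp add: regularly_varying_def)
  ultimately have "\<forall>\<^sub>F t in at_top. 0 < F t \<and> F (exp 1 * t) / F t < exp (- \<alpha> / 2)"
    by eventually_elim simp
  then obtain N where N: "\<And>t. N \<le> t \<Longrightarrow> 0 < F t \<and> F (exp 1 * t) / F t < exp (- \<alpha> / 2)"
    unfolding eventually_at_top_linorder by blast
  \<comment> \<open>A positive \<open>T\<close> ensures that multiplying \<open>t\<close> by an
    exponential of a nonnegative number does not leave the range where the one-step bound
    holds.\<close>
  define T where "T = max 1 N"
  have T: "0 < F t" "F (t * exp 1) \<le> exp (- \<alpha> / 2) * F t" if "T \<le> t" for t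
  proof -
    have t: "0 < F t" "F (exp 1 * t) / F t < exp (- \<alpha> / 2)" using N[of t] that by (auto simp: T_def)
    then show "0 < F t" "F (t * exp 1) \<le> exp (- \<alpha> / 2) * F t"
      by (auto simp: pos_divide_less_eq mult.commute intro: less_imp_le)
  qed
  have iter: "F (t * exp (real i)) \<le> exp (- \<alpha> / 2 * real i) * F t" if "T \<le> t" for t i
  proof (induction i)
    case (Suc i)
    have "1 \<le> T" by (simp add: T_def)
    then have "T * 1 \<le> t * exp (real i)" using that by (intro mult_mono) auto
    then have "F (t * exp (real i) * exp 1) \<le> exp (- \<alpha> / 2) * F (t * exp (real i))"
      by (intro T) simp
    also have "\<dots> \<le> exp (- \<alpha> / 2) * (exp (- \<alpha> / 2 * real i) * F t)"
      using Suc by simp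
    also have "\<dots> = exp (- \<alpha> / 2 + - \<alpha> / 2 * real i) * F t"
      by (simp only: exp_add mult.assoc)
    also have "- \<alpha> / 2 + - \<alpha> / 2 * real i = - \<alpha> / 2 * real (Suc i)" by (simp add: field_simps)
    also have "t * exp (real i) * exp 1 = t * exp (real (Suc i))"
      by (simp add: exp_add[symmetric] add.commute)
    finally show ?case .
  qed simp
  have "F (t * exp u) \<le> exp (\<alpha> / 2) * exp (- (\<alpha> / 2) * u) * F t" if "T \<le> t" "0 \<le> u" for t u
  proof -
    \<comment> \<open>Rounding \<open>u\<close> down loses less than 1 in the exponent, which
      accounts for the factor \<open>exp (\<alpha> / 2)\<close>.\<close>
    let ?i = "nat \<lfloor>u\<rfloor>"
    have i: "real ?i \<le> u" "u \<le> real ?i + 1" using that by linarith+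
    have "t * exp (real ?i) \<le> t * exp u" using i that by (auto simp: T_def)
    then have "F (t * exp u) \<le> F (t * exp (real ?i))" using F by (auto simp: antimono_def)
    also have "\<dots> \<le> exp (- \<alpha> / 2 * real ?i) * F t" by (rule iter[OF that(1)])
    also have "\<dots> \<le> exp (\<alpha> / 2 + - (\<alpha> / 2) * u) * F t"
    proof (intro mult_right_mono)
      have "\<alpha> / 2 * u \<le> \<alpha> / 2 * (real ?i + 1)" using i \<alpha> by (intro mult_left_mono) auto
      then show "exp (- \<alpha> / 2 * real ?i) \<le> exp (\<alpha> / 2 + - (\<alpha> / 2) * u)"
        by (simp add: algebra_simps)
    qed (use T(1)[OF that(1)] in simp)
    finally show ?thesis by (simp only: exp_add)
  qed
  then show ?thesis
    using T by (intro exI[of _ T]) (auto simp: T_def)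
qed

section \<open>Tail probabilities and moments of the log-excess\<close>

definition tail_prob :: "'a measure \<Rightarrow> ('a \<Rightarrow> real) \<Rightarrow> real \<Rightarrow> real" where
  "tail_prob P X x = measure P {\<omega> \<in> space P. x < X \<omega>}"

lemma (in prob_space) antimono_tail_prob:
  assumes [measurable]: "random_variable borel X"
  shows "antimono (tail_prob M X)"
  unfolding tail_prob_def by (intro antimonoI finite_measure_mono) auto

lemma (in prob_space) borel_measurable_tail_prob:
  assumes "random_variable borel X"
  shows "tail_prob M X \<in> borel_measurable borel"
proof -
  have "(\<lambda>x. - tail_prob M X x) \<in> borel_measurable borel"
    using antimono_tail_prob[OF assms] by (intro borel_measurable_mono) (auto simp: mono_def antimono_def)
  then have "(\<lambda>x. - (- tail_prob M X x)) \<in> borel_measurable borel" by (rule borel_measurable_uminus)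
  then show ?thesis by simp
qed

text \<open>The layer-cake formula: write the power as the integral of its derivative and exchange
  the integrals by Tonelli. For \<open>u \<ge> 0\<close> the log-excess exceeds \<open>u\<close>
  exactly when \<open>X\<close> exceeds \<open>t * exp u\<close>.\<close>

lemma (in prob_space) nn_integral_log_excess_power:
  assumes X[measurable]: "random_variable borel X" and t: "0 < t"
  shows "(\<integral>\<^sup>+\<omega>. ennreal (ln (max 1 (X \<omega> / t)) ^ Suc k) \<partial>M) =
    (\<integral>\<^sup>+u. ennreal (indicator {0..} u * (real (Suc k) * u ^ k * tail_prob M X (t * exp u))) \<partial>lborel)"
proof -
  interpret pair_sigma_finite lborel M ..
  \<comment> \<open>The half-open interval matches the strict inequality in
    \<open>tail_prob\<close>; its missing endpoint is a null set.\<close>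
  have power: "ennreal (y ^ Suc k) =
      (\<integral>\<^sup>+u. ennreal (real (Suc k) * u ^ k) * indicator {0..<y} u \<partial>lborel)" if "0 \<le> y" for y :: real
  proof -
    have "(\<integral>\<^sup>+u. ennreal (real (Suc k) * u ^ k) * indicator {0..<y} u \<partial>lborel) =
        (\<integral>\<^sup>+u. ennreal (real (Suc k) * u ^ k) * indicator {0..y} u \<partial>lborel)"
      using AE_lborel_singleton[of y]
      by (intro nn_integral_cong_AE) (auto split: split_indicator elim: eventually_mono)
    also have "\<dots> = ennreal (y ^ Suc k - 0 ^ Suc k)"
      using that by (intro nn_integral_FTC_Icc)
        (auto intro!: derivative_eq_intros simp del: power_Suc)
    finally show ?thesis by simp
  qed
  have excess: "u \<in> {0..<ln (max 1 (x / t))} \<longleftrightarrow> 0 \<le> u \<and> t * exp u < x" for u x :: real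
  proof -
    have "u < ln (max 1 (x / t)) \<longleftrightarrow> exp u < max 1 (x / t)" 
      by (metis exp_less_cancel_iff exp_ln less_max_iff_disj zero_less_one)
    moreover have "exp u < max 1 (x / t) \<longleftrightarrow> t * exp u < x" if "0 \<le> u"
    proof -
      have "1 \<le> exp u" using that by simp
      then have "exp u < max 1 (x / t) \<longleftrightarrow> exp u < x / t" by (auto simp: less_max_iff_disj)
      then show ?thesis using t by (simp add: pos_less_divide_eq mult.commute)
    qed
    ultimately show ?thesis by auto
  qed
  define f where "f u \<omega> = ennreal (indicator {0..} u * (real (Suc k) * u ^ k)) *
    indicator {\<omega> \<in> space M. t * exp u < X \<omega>} \<omega>" for u \<omega>
  have "(\<integral>\<^sup>+\<omega>. ennreal (ln (max 1 (X \<omega> / t)) ^ Suc k) \<partial>M) = (\<integral>\<^sup>+\<omega>. \<integral>\<^sup>+u. f u \<omega> \<partial>lborel \<partial>M)"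
  proof (rule nn_integral_cong)
    fix \<omega> assume \<omega>: "\<omega> \<in> space M"
    have "ennreal (real (Suc k) * u ^ k) * indicator {0..<ln (max 1 (X \<omega> / t))} u = f u \<omega>" for u
      using excess[of u "X \<omega>"] \<omega> unfolding f_def by (auto simp: indicator_def)
    then show "ennreal (ln (max 1 (X \<omega> / t)) ^ Suc k) = (\<integral>\<^sup>+u. f u \<omega> \<partial>lborel)"
      by (subst power) (auto simp: max_def)
  qed
  also have "\<dots> = (\<integral>\<^sup>+u. \<integral>\<^sup>+\<omega>. f u \<omega> \<partial>M \<partial>lborel)"
    unfolding f_def by (rule Fubini') measurable
  also have "\<dots> = (\<integral>\<^sup>+u. ennreal (indicator {0..} u * (real (Suc k) * u ^ k * tail_prob M X (t * exp u))) \<partial>lborel)"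
  proof (rule nn_integral_cong)
    fix u
    have "(\<integral>\<^sup>+\<omega>. f u \<omega> \<partial>M) = ennreal (indicator {0..} u * (real (Suc k) * u ^ k)) *
        emeasure M {\<omega> \<in> space M. t * exp u < X \<omega>}"
      unfolding f_def by (subst nn_integral_cmult_indicator) auto
    also have "\<dots> = ennreal (indicator {0..} u * (real (Suc k) * u ^ k)) * ennreal (tail_prob M X (t * exp u))"
      by (simp add: tail_prob_def emeasure_eq_measure)
    also have "\<dots> = ennreal (indicator {0..} u * (real (Suc k) * u ^ k) * tail_prob M X (t * exp u))"
      by (subst ennreal_mult) (auto simp: tail_prob_def split: split_indicator)
    finally show "(\<integral>\<^sup>+\<omega>. f u \<omega> \<partial>M) =
      ennreal (indicator {0..} u * (real (Suc k) * u ^ k * tail_prob M X (t * exp u)))"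
      by (simp add: mult.assoc)
  qed
  finally show ?thesis .
qed

text \<open>Up to a constant the integrand is the Erlang density, whose total mass is its moment of
  order 0.\<close>

lemma
  assumes "0 < (l :: real)"
  shows integrable_power_exp: "integrable lborel (\<lambda>u. indicator {0..} u * (u ^ k * exp (- l * u)))"
    and integral_power_exp:
      "(\<integral>u. indicator {0..} u * (u ^ k * exp (- l * u)) \<partial>lborel) = fact k / l ^ Suc k"
proof -
  have eq: "indicator {0..} u * (u ^ k * exp (- l * u)) = fact k / l ^ Suc k * erlang_density k l u" for u
    using assms by (auto simp: erlang_density_def indicator_def)
  have nn: "(\<integral>\<^sup>+u. ennreal (erlang_density k l u) \<partial>lborel) = ennreal 1"
    using nn_integral_erlang_ith_moment[OF assms, of k 0] by simp
  have "has_bochner_integral lborel (erlang_density k l) 1"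
    by (rule has_bochner_integral_nn_integral) (use assms nn in auto)
  then have "has_bochner_integral lborel (\<lambda>u. fact k / l ^ Suc k * erlang_density k l u) (fact k / l ^ Suc k * 1)"
    by (rule has_bochner_integral_mult_right)
  then show "integrable lborel (\<lambda>u. indicator {0..} u * (u ^ k * exp (- l * u)))"
    "(\<integral>u. indicator {0..} u * (u ^ k * exp (- l * u)) \<partial>lborel) = fact k / l ^ Suc k"
    unfolding eq by (simp_all add: has_bochner_integral_iff)
qed

text \<open>Dominated convergence in the layer-cake formula divided by the tail at
  \<open>t n\<close>: the ratio of tails tends to \<open>exp (- \<alpha> * u)\<close> by regular
  variation and is dominated through the Potter bound. The limit integral is
  \<open>Suc k * fact k / \<alpha> ^ Suc k\<close>.\<close>

lemma (in prob_space) log_excess_moment: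
  assumes X[measurable]: "random_variable borel X"
    and rv: "regularly_varying (tail_prob M X) (- \<alpha>)" and \<alpha>: "0 < \<alpha>"
    and t: "filterlim t at_top sequentially"
  shows "\<forall>\<^sub>F n in sequentially. integrable M (\<lambda>\<omega>. ln (max 1 (X \<omega> / t n)) ^ Suc k)"
    and "(\<lambda>n. expectation (\<lambda>\<omega>. ln (max 1 (X \<omega> / t n)) ^ Suc k) / tail_prob M X (t n))
      \<longlonglongrightarrow> fact (Suc k) / \<alpha> ^ Suc k"
proof -
  let ?F = "tail_prob M X"
  note borel_measurable_tail_prob[OF X, measurable]
  obtain T where T: "0 < T" "\<And>s. T \<le> s \<Longrightarrow> 0 < ?F s"
    "\<And>s u. T \<le> s \<Longrightarrow> 0 \<le> u \<Longrightarrow> ?F (s * exp u) \<le> exp (\<alpha> / 2) * exp (- (\<alpha> / 2) * u) * ?F s"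
    using regularly_varying_potter[OF rv antimono_tail_prob[OF X] \<alpha>] by blast
  have ev: "\<forall>\<^sub>F n in sequentially. T \<le> t n"
    using t unfolding filterlim_at_top by blast
  \<comment> \<open>Replacing the ratio by 0 until \<open>t n\<close> reaches \<open>T\<close> makes
    the domination hold for every \<open>n\<close>, while the limit is unaffected.\<close>
  define s where "s n u = indicator {0..} u *
    (real (Suc k) * u ^ k * (if T \<le> t n then ?F (t n * exp u) / ?F (t n) else 0))" for n u
  define w where "w u = real (Suc k) * exp (\<alpha> / 2) *
    (indicator {0..} u * (u ^ k * exp (- (\<alpha> / 2) * u)))" for u
  define f where "f u = real (Suc k) * (indicator {0..} u * (u ^ k * exp (- \<alpha> * u)))" for u
  have s0: "0 \<le> s n u" for n u
    by (auto simp: s_def tail_prob_def split: split_indicator)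
  have sw: "s n u \<le> w u" for n u
  proof (cases "T \<le> t n \<and> 0 \<le> u")
    case True
    then have "?F (t n * exp u) / ?F (t n) \<le> exp (\<alpha> / 2) * exp (- (\<alpha> / 2) * u)"
      using T(2)[of "t n"] T(3)[of "t n" u] by (simp add: pos_divide_le_eq)
    then have "real (Suc k) * u ^ k * (?F (t n * exp u) / ?F (t n)) \<le>
        real (Suc k) * u ^ k * (exp (\<alpha> / 2) * exp (- (\<alpha> / 2) * u))"
      using True by (intro mult_left_mono) auto
    then show ?thesis using True by (simp add: s_def w_def mult_ac)
  next
    case False
    then show ?thesis by (auto simp: s_def w_def split: split_indicator)
  qed
  have s_meas: "s n \<in> borel_measurable lborel" for n unfolding s_def by measurable
  have f_meas: "f \<in> borel_measurable lborel" unfolding f_def by measurable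
  have w_int: "integrable lborel w"
    unfolding w_def using \<alpha> integrable_power_exp[of "\<alpha> / 2" k] by (intro integrable_mult_right) auto
  have s_lim: "(\<lambda>n. s n u) \<longlonglongrightarrow> f u" for u
  proof (cases "0 \<le> u")
    case True
    have "(\<lambda>n. ?F (exp u * t n) / ?F (t n)) \<longlonglongrightarrow> exp (- \<alpha> * u)"
      using filterlim_compose[OF regularly_varying_tendsto[OF rv, of "exp u"] t]
      by (simp add: powr_def)
    moreover have "\<forall>\<^sub>F n in sequentially. ?F (exp u * t n) / ?F (t n) =
        (if T \<le> t n then ?F (t n * exp u) / ?F (t n) else 0)"
      using ev by eventually_elim (simp add: mult.commute)
    ultimately have "(\<lambda>n. if T \<le> t n then ?F (t n * exp u) / ?F (t n) else 0) \<longlonglongrightarrow> exp (- \<alpha> * u)"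
      by (rule Lim_transform_eventually)
    then have "(\<lambda>n. real (Suc k) * u ^ k * (if T \<le> t n then ?F (t n * exp u) / ?F (t n) else 0))
        \<longlonglongrightarrow> real (Suc k) * u ^ k * exp (- \<alpha> * u)" by (rule tendsto_mult_left)
    then show ?thesis using True by (simp add: s_def f_def mult_ac)
  next
    case False
    then show ?thesis by (simp add: s_def f_def)
  qed
  have norm: "norm (s n u) \<le> w u" for n u using s0 sw by simp
  have int_lim: "(\<lambda>n. integral\<^sup>L lborel (s n)) \<longlonglongrightarrow> integral\<^sup>L lborel f"
    and s_int: "\<And>n. integrable lborel (s n)"
    using integral_dominated_convergence[OF f_meas s_meas w_int AE_I2[OF s_lim] AE_I2[OF norm]]
      integrable_dominated_convergence2[OF f_meas s_meas w_int AE_I2[OF s_lim] AE_I2[OF norm]] by auto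
  have f_int: "integral\<^sup>L lborel f = fact (Suc k) / \<alpha> ^ Suc k"
    unfolding f_def using integral_power_exp[OF \<alpha>, of k] integrable_power_exp[OF \<alpha>, of k] by simp
  \<comment> \<open>Once \<open>T \<le> t n\<close>, the rescaled integral of \<open>s n\<close> is
    exactly the moment, not merely close to it.\<close>
  have moment: "has_bochner_integral M (\<lambda>\<omega>. ln (max 1 (X \<omega> / t n)) ^ Suc k)
      (?F (t n) * integral\<^sup>L lborel (s n))" if "T \<le> t n" for n
  proof (rule has_bochner_integral_nn_integral)
    have "0 < t n" using T(1) that by simp
    have "(\<integral>\<^sup>+\<omega>. ennreal (ln (max 1 (X \<omega> / t n)) ^ Suc k) \<partial>M) =
        (\<integral>\<^sup>+u. ennreal (?F (t n) * s n u) \<partial>lborel)"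
      unfolding nn_integral_log_excess_power[OF X \<open>0 < t n\<close>]
      using T(2)[OF that] that by (intro nn_integral_cong) (simp add: s_def)
    also have "\<dots> = ennreal (\<integral>u. ?F (t n) * s n u \<partial>lborel)"
      using T(2)[OF that] s0 s_int by (intro nn_integral_eq_integral) auto
    finally show "(\<integral>\<^sup>+\<omega>. ennreal (ln (max 1 (X \<omega> / t n)) ^ Suc k) \<partial>M) =
        ennreal (?F (t n) * integral\<^sup>L lborel (s n))" by simp
  qed (use s0 T(2)[OF that] in \<open>auto simp: less_imp_le\<close>)
  show "\<forall>\<^sub>F n in sequentially. integrable M (\<lambda>\<omega>. ln (max 1 (X \<omega> / t n)) ^ Suc k)"
    using ev by eventually_elim (metis moment has_bochner_integral_iff)
  show "(\<lambda>n. expectation (\<lambda>\<omega>. ln (max 1 (X \<omega> / t n)) ^ Suc k) / ?F (t n))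
      \<longlonglongrightarrow> fact (Suc k) / \<alpha> ^ Suc k"
  proof (rule Lim_transform_eventually[OF int_lim[unfolded f_int]])
    show "\<forall>\<^sub>F n in sequentially. integral\<^sup>L lborel (s n) =
        expectation (\<lambda>\<omega>. ln (max 1 (X \<omega> / t n)) ^ Suc k) / ?F (t n)"
      using ev
    proof eventually_elim
      case (elim n)
      then show ?case
        using has_bochner_integral_integral_eq[OF moment[OF elim]] T(2)[OF elim] by simp
    qed
  qed
qed

lemma (in prob_space) tail_prob_tendsto_0:
  assumes [measurable]: "random_variable borel X"
  shows "(tail_prob M X \<longlongrightarrow> 0) at_top"
proof -
  interpret X: real_distribution "distr M borel X" by (rule real_distribution_distr) simp
  have "tail_prob M X x = 1 - cdf (distr M borel X) x" for x
  proof -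
    have "cdf (distr M borel X) x = prob {\<omega> \<in> space M. X \<omega> \<le> x}"
      unfolding cdf_def by (subst measure_distr) (auto simp: vimage_def Int_def conj_commute)
    moreover have "tail_prob M X x = prob (space M - {\<omega> \<in> space M. X \<omega> \<le> x})"
      unfolding tail_prob_def by (intro arg_cong[where f=prob]) auto
    ultimately show ?thesis by (simp add: prob_compl)
  qed
  then have "tail_prob M X = (\<lambda>x. 1 - cdf (distr M borel X) x)" by auto
  moreover have "((\<lambda>x. 1 - cdf (distr M borel X) x) \<longlongrightarrow> 1 - 1) at_top"
    by (intro tendsto_diff tendsto_const X.cdf_lim_at_top_prob)
  ultimately show ?thesis by simp
qed

text \<open>Two instances of the triangular weak law, normalised by the tail at \<open>s n\<close>.
  In both the second moment is of the order of that tail, so the variance condition reduces to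
  \<open>lim\<close>.\<close>

lemma (in prob_space)
  fixes H :: "nat \<Rightarrow> 'a \<Rightarrow> real"
  assumes iid: "iid M H" and rv: "regularly_varying (tail_prob M (H 1)) (- \<alpha>)" and \<alpha>: "0 < \<alpha>"
    and s: "filterlim s at_top sequentially"
    and lim: "filterlim (\<lambda>n. real n * tail_prob M (H 1) (s n)) at_top sequentially"
  shows tail_count_tendsto_whp:
      "((\<lambda>z. tail_count (\<lambda>j. H j (snd z)) (fst z) (s (fst z)) /
        (real (fst z) * tail_prob M (H 1) (s (fst z)))) \<longlongrightarrow> 1) (whp M)"
    and log_excess_tendsto_whp:
      "((\<lambda>z. log_excess (\<lambda>j. H j (snd z)) (fst z) (s (fst z)) /
        (real (fst z) * tail_prob M (H 1) (s (fst z)))) \<longlongrightarrow> 1 / \<alpha>) (whp M)"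
proof -
  let ?F = "tail_prob M (H 1)"
  have H[measurable]: "random_variable borel (H 1)"
    using iid unfolding iid_def indep_vars_def by auto
  have pos: "\<forall>\<^sub>F n in sequentially. 0 < ?F (s n)"
    using rv s unfolding regularly_varying_def filterlim_iff by blast
  have inv: "(\<lambda>n. inverse (real n * ?F (s n))) \<longlonglongrightarrow> 0"
    using lim by (rule tendsto_inverse_0_at_top)
  have E: "expectation (\<lambda>\<omega>. of_bool (s n < H 1 \<omega>)) = ?F (s n)" for n
  proof -
    have "expectation (\<lambda>\<omega>. of_bool (s n < H 1 \<omega>)) = expectation (indicator {\<omega> \<in> space M. s n < H 1 \<omega>})"
      by (intro Bochner_Integration.integral_cong) (auto simp: indicator_def)
    also have "\<dots> = prob {\<omega> \<in> space M. s n < H 1 \<omega>}"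
      by (subst Bochner_Integration.integral_indicator) (auto intro: arg_cong[where f=prob])
    finally show ?thesis by (simp add: tail_prob_def)
  qed
  show "((\<lambda>z. tail_count (\<lambda>j. H j (snd z)) (fst z) (s (fst z)) /
      (real (fst z) * ?F (s (fst z)))) \<longlongrightarrow> 1) (whp M)"
    unfolding tail_count_def
  proof (rule weak_law_triangular[OF iid _ _ pos])
    show "(\<lambda>x. of_bool (s n < x) :: real) \<in> borel_measurable borel" for n by measurable
    show "\<forall>\<^sub>F n in sequentially. integrable M (\<lambda>\<omega>. (of_bool (s n < H 1 \<omega>) :: real)\<^sup>2)"
      by (intro always_eventually allI integrable_const_bound[where B=1]) (simp, measurable)
    show "(\<lambda>n. expectation (\<lambda>\<omega>. of_bool (s n < H 1 \<omega>)) / ?F (s n)) \<longlonglongrightarrow> 1"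
      unfolding E by (rule tendsto_eventually) (use pos in eventually_elim, simp)
    show "(\<lambda>n. expectation (\<lambda>\<omega>. (of_bool (s n < H 1 \<omega>))\<^sup>2) / (real n * (?F (s n))\<^sup>2)) \<longlonglongrightarrow> 0"
    proof (rule Lim_transform_eventually[OF inv])
      have sq: "(of_bool b :: real)\<^sup>2 = of_bool b" for b by simp
      show "\<forall>\<^sub>F n in sequentially. inverse (real n * ?F (s n)) =
          expectation (\<lambda>\<omega>. (of_bool (s n < H 1 \<omega>))\<^sup>2) / (real n * (?F (s n))\<^sup>2)"
        unfolding sq E using pos by eventually_elim (simp add: power2_eq_square field_simps)
    qed
  qed
  let ?l = "\<lambda>n x. ln (max 1 (x / s n))"
  show "((\<lambda>z. log_excess (\<lambda>j. H j (snd z)) (fst z) (s (fst z)) /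
      (real (fst z) * ?F (s (fst z)))) \<longlongrightarrow> 1 / \<alpha>) (whp M)"
    unfolding log_excess_def
  proof (rule weak_law_triangular[OF iid _ _ pos, of ?l])
    show "?l n \<in> borel_measurable borel" for n by measurable
    show "\<forall>\<^sub>F n in sequentially. integrable M (\<lambda>\<omega>. (?l n (H 1 \<omega>))\<^sup>2)"
      using log_excess_moment(1)[OF H rv \<alpha> s, of 1] by (simp add: numeral_2_eq_2)
    show "(\<lambda>n. expectation (\<lambda>\<omega>. ?l n (H 1 \<omega>)) / ?F (s n)) \<longlonglongrightarrow> 1 / \<alpha>"
      using log_excess_moment(2)[OF H rv \<alpha> s, of 0] by simp
    have "(\<lambda>n. expectation (\<lambda>\<omega>. (?l n (H 1 \<omega>))\<^sup>2) / ?F (s n) * inverse (real n * ?F (s n)))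
        \<longlonglongrightarrow> fact (Suc 1) / \<alpha> ^ Suc 1 * 0"
      using log_excess_moment(2)[OF H rv \<alpha> s, of 1] inv
      by (intro tendsto_mult) (simp_all add: numeral_2_eq_2)
    then show "(\<lambda>n. expectation (\<lambda>\<omega>. (?l n (H 1 \<omega>))\<^sup>2) / (real n * (?F (s n))\<^sup>2)) \<longlonglongrightarrow> 0"
      by (simp add: power2_eq_square field_simps)
  qed
qed

text \<open>
  \<open>F\<close> may jump, so the level \<open>q\<close> is only bracketed; regular variation makes the factor 2 harmless.
\<close>

lemma ex_tail_quantile:
  fixes F :: "real \<Rightarrow> real"
  assumes F: "antimono F" "\<And>x. 0 < F x" "(F \<longlongrightarrow> 0) at_top"
    and q: "\<forall>\<^sub>F n in sequentially. 0 < q n" "q \<longlonglongrightarrow> 0"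
  shows "\<exists>t. filterlim t at_top sequentially \<and>
    (\<forall>\<^sub>F n in sequentially. F (t n) \<le> q n \<and> q n < F (t n / 2))"
proof -
  \<comment> \<open>The first power of two at which \<open>F\<close> has dropped to
    \<open>q n\<close>; at the preceding power \<open>F\<close> is still above \<open>q n\<close>,
    which gives the bracket.\<close>
  define m where "m n = (LEAST m. F (2 ^ m) \<le> q n)" for n
  have "filterlim (\<lambda>m. 2 ^ m :: real) at_top sequentially"
    by (intro filterlim_at_infinity_imp_filterlim_at_top filterlim_realpow_sequentially_gt1) auto
  then have F2: "(\<lambda>m. F (2 ^ m)) \<longlonglongrightarrow> 0" by (rule filterlim_compose[OF F(3)])
  have m: "\<forall>\<^sub>F n in sequentially. F (2 ^ m n) \<le> q n"
    using q(1)
  proof eventually_elim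
    case (elim n)
    have "\<forall>\<^sub>F m in sequentially. F (2 ^ m) < q n" using order_tendstoD(2)[OF F2 elim] .
    then obtain m' where "F (2 ^ m') < q n"
      using eventually_happens'[OF sequentially_bot] by blast
    then show ?case
      unfolding m_def by (rule LeastI[of "\<lambda>m. F (2 ^ m) \<le> q n" m', OF less_imp_le])
  qed
  \<comment> \<open>Since \<open>F (2 ^ K)\<close> is positive and \<open>q\<close> tends to 0, the
    level is eventually not yet reached at exponent \<open>K\<close>.\<close>
  have large: "\<forall>\<^sub>F n in sequentially. K < m n" for K
    using m order_tendstoD(2)[OF q(2) F(2)[of "2 ^ K"]]
  proof eventually_elim
    case (elim n)
    show ?case
    proof (rule ccontr)
      assume "\<not> K < m n"
      then have "(2 :: real) ^ m n \<le> 2 ^ K" by simp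
      then have "F (2 ^ K) \<le> F (2 ^ m n)" using F(1) by (simp add: antimono_def)
      then show False using elim by simp
    qed
  qed
  have "filterlim (\<lambda>n. 2 ^ m n :: real) at_top sequentially"
  proof (rule filterlim_compose[of "\<lambda>m. 2 ^ m"])
    show "filterlim m at_top sequentially"
      unfolding filterlim_at_top
    proof
      fix K show "\<forall>\<^sub>F n in sequentially. K \<le> m n" using large[of K] by eventually_elim simp
    qed
  qed fact
  moreover have "\<forall>\<^sub>F n in sequentially. F (2 ^ m n) \<le> q n \<and> q n < F (2 ^ m n / 2)"
    using m large[of 0]
  proof eventually_elim
    case (elim n)
    have "\<not> F (2 ^ (m n - 1)) \<le> q n"
      using elim(2) unfolding m_def by (intro not_less_Least) simp
    moreover have "(2 :: real) ^ m n / 2 = 2 ^ (m n - 1)"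
      using elim(2) by (cases "m n") auto
    ultimately show ?case using elim(1) by simp
  qed
  ultimately show ?thesis by blast
qed

section \<open>Sandwiching the Hill statistic\<close>

text \<open>Stated along an arbitrary filter, so that only limits and order enter. The bounds on
  \<open>k\<close> confine the threshold to a range covered by finitely many grid levels, which
  makes the pointwise limits in \<open>s\<close> enough.\<close>

lemma tendsto_hillI:
  fixes x :: "'z \<Rightarrow> nat \<Rightarrow> real"
  assumes \<alpha>: "0 < \<alpha>"
    and N: "\<And>s. 0 < s \<Longrightarrow> ((\<lambda>z. tail_count (x z) (n z) (s * t z) / v z) \<longlongrightarrow> s powr - \<alpha>) W"
    and L: "\<And>s. 0 < s \<Longrightarrow> ((\<lambda>z. log_excess (x z) (n z) (s * t z) / v z) \<longlongrightarrow> s powr - \<alpha> / \<alpha>) W"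
    and tv: "\<forall>\<^sub>F z in W. 0 < t z \<and> 0 < v z"
    and kn: "\<forall>\<^sub>F z in W. 1 \<le> k z \<and> k z \<le> n z"
    and k: "\<forall>\<^sub>F z in W. c * v z \<le> real (k z) \<and> real (k z) \<le> C * v z" and c: "0 < c" "0 < C"
  shows "((\<lambda>z. hill (x z) (n z) (k z)) \<longlongrightarrow> 1 / \<alpha>) W"
proof (rule tendstoI)
  fix e :: real assume e: "0 < e"
  have "\<forall>\<^sub>F l in at_right 1. 1 < l \<and> l powr \<alpha> / \<alpha> < 1 / \<alpha> + e \<and> 1 / \<alpha> - e < l powr - \<alpha> / \<alpha>"
  proof (intro eventually_conj)
    have "((\<lambda>l. l powr \<alpha> / \<alpha>) \<longlongrightarrow> 1 powr \<alpha> / \<alpha>) (at_right 1)"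
      using \<alpha> by (intro tendsto_intros) auto
    then show "\<forall>\<^sub>F l in at_right 1. l powr \<alpha> / \<alpha> < 1 / \<alpha> + e"
      by (rule order_tendstoD) (use e in simp)
    have "((\<lambda>l. l powr - \<alpha> / \<alpha>) \<longlongrightarrow> 1 powr - \<alpha> / \<alpha>) (at_right 1)"
      using \<alpha> by (intro tendsto_intros) auto
    then show "\<forall>\<^sub>F l in at_right 1. 1 / \<alpha> - e < l powr - \<alpha> / \<alpha>"
      by (rule order_tendstoD) (use e in simp)
  qed (simp add: eventually_at_right_less)
  then obtain l where l: "1 < l" "l powr \<alpha> / \<alpha> < 1 / \<alpha> + e" "1 / \<alpha> - e < l powr - \<alpha> / \<alpha>"
    using eventually_happens'[OF trivial_limit_at_right_real] by blast
  \<comment> \<open>The count at \<open>a * t\<close> is eventually above \<open>C * v\<close>,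
    having limit \<open>C + 1\<close> after division by \<open>v\<close>; the count at
    \<open>b * t\<close> is below \<open>c * v\<close>, having limit \<open>c / 2\<close>. Hence the
    threshold lies between these levels.\<close>
  define a where "a = (C + 1) powr (- 1 / \<alpha>)"
  define b where "b = (c / 2) powr (- 1 / \<alpha>)"
  have ab: "0 < a" "0 < b" "a powr - \<alpha> = C + 1" "b powr - \<alpha> = c / 2"
    using c \<alpha> unfolding a_def b_def by (auto simp: powr_powr)
  obtain m where "b / a < l ^ m" using real_arch_pow[OF l(1)] by blast
  then have m: "b \<le> a * l ^ m" using ab by (simp add: pos_divide_less_eq mult.commute)
  \<comment> \<open>A geometric grid of ratio \<open>l\<close> that starts at \<open>a\<close> and
    has passed \<open>b\<close> after \<open>m\<close> steps.\<close>
  define g where "g i = a * l ^ i" for i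
  have g: "0 < g i" "g i \<le> g (Suc i)" "g (Suc i) powr - \<alpha> = g i powr - \<alpha> * l powr - \<alpha>" for i
    using ab l by (auto simp: g_def powr_mult)
  let ?N = "\<lambda>s z. tail_count (x z) (n z) (s * t z)" and ?L = "\<lambda>s z. log_excess (x z) (n z) (s * t z)"
  have quot: "((\<lambda>z. ?L s z / ?N s' z) \<longlongrightarrow> s powr - \<alpha> / \<alpha> / s' powr - \<alpha>) W"
    if "0 < s" "0 < s'" for s s'
  proof (rule Lim_transform_eventually)
    show "((\<lambda>z. (?L s z / v z) / (?N s' z / v z)) \<longlongrightarrow> s powr - \<alpha> / \<alpha> / s' powr - \<alpha>) W"
      using that by (intro tendsto_divide L N) auto
    show "\<forall>\<^sub>F z in W. (?L s z / v z) / (?N s' z / v z) = ?L s z / ?N s' z"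
      using tv by eventually_elim simp
  qed
  have "\<forall>\<^sub>F z in W. 0 < ?N (g (Suc i)) z \<and> ?L (g i) z / ?N (g (Suc i)) z < 1 / \<alpha> + e \<and>
      1 / \<alpha> - e < ?L (g (Suc i)) z / ?N (g i) z" for i
  proof (intro eventually_conj)
    have "\<forall>\<^sub>F z in W. 0 < ?N (g (Suc i)) z / v z"
      using g(1)[of "Suc i"] by (intro order_tendstoD(1)[OF N]) auto
    then show "\<forall>\<^sub>F z in W. 0 < ?N (g (Suc i)) z"
      using tv by eventually_elim (simp add: zero_less_divide_iff)
    have "g i powr - \<alpha> / \<alpha> / g (Suc i) powr - \<alpha> = l powr \<alpha> / \<alpha>"
      using g(1)[of i] l(1) unfolding g(3) by (simp add: powr_minus field_simps)
    then show "\<forall>\<^sub>F z in W. ?L (g i) z / ?N (g (Suc i)) z < 1 / \<alpha> + e"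
      using l(2) by (intro order_tendstoD(2)[OF quot] g) simp
    have "g (Suc i) powr - \<alpha> / \<alpha> / g i powr - \<alpha> = l powr - \<alpha> / \<alpha>"
      using g(1)[of i] l(1) unfolding g(3) by simp
    then show "\<forall>\<^sub>F z in W. 1 / \<alpha> - e < ?L (g (Suc i)) z / ?N (g i) z"
      using l(3) by (intro order_tendstoD(1)[OF quot] g) simp
  qed
  then have "\<forall>\<^sub>F z in W. \<forall>i\<in>{..<m}. 0 < ?N (g (Suc i)) z \<and> ?L (g i) z / ?N (g (Suc i)) z < 1 / \<alpha> + e \<and>
      1 / \<alpha> - e < ?L (g (Suc i)) z / ?N (g i) z"
    by (intro eventually_ball_finite) auto
  moreover have "\<forall>\<^sub>F z in W. C < ?N a z / v z"
    using ab by (intro order_tendstoD(1)[OF N]) auto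
  moreover have "\<forall>\<^sub>F z in W. ?N b z / v z < c"
    using ab c by (intro order_tendstoD(2)[OF N]) auto
  ultimately show "\<forall>\<^sub>F z in W. dist (hill (x z) (n z) (k z)) (1 / \<alpha>) < e"
    using tv kn k
  proof eventually_elim
    case (elim z)
    have ka: "real (k z) \<le> ?N (g 0) z" using elim by (simp add: g_def pos_less_divide_eq)
    have "?N (g m) z \<le> ?N b z"
      using m elim by (intro tail_count_antimono mult_right_mono) (auto simp: g_def)
    also have "\<dots> < real (k z)" using elim by (simp add: pos_divide_less_eq)
    finally have km: "\<not> real (k z) \<le> ?N (g m) z" by simp
    \<comment> \<open>The count is at least \<open>k\<close> at the first grid level and below
      \<open>k\<close> at the last, so it crosses \<open>k\<close> between two neighbours.\<close>
    have "\<exists>i<m. real (k z) \<le> ?N (g i) z \<and> \<not> real (k z) \<le> ?N (g (Suc i)) z"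
      using ka km by (induction m) (auto simp: less_Suc_eq)
    then obtain i where i: "i < m" "real (k z) \<le> ?N (g i) z" "?N (g (Suc i)) z < real (k z)"
      by (auto simp: not_le)
    have gi: "0 < ?N (g (Suc i)) z" "?L (g i) z / ?N (g (Suc i)) z < 1 / \<alpha> + e"
      "1 / \<alpha> - e < ?L (g (Suc i)) z / ?N (g i) z" using elim(1) i(1) by auto
    have between: "?L (g (Suc i)) z / real (k z) \<le> hill (x z) (n z) (k z)"
      "hill (x z) (n z) (k z) \<le> ?L (g i) z / real (k z)"
      using elim g[of i] i by (intro hill_between[where s="g i * t z" and t="g (Suc i) * t z"]; simp)+
    have L0: "0 \<le> ?L s z" for s unfolding log_excess_def by (intro sum_nonneg) auto
    \<comment> \<open>The index \<open>k\<close> lies between the counts at the two neighbouring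
      levels; replacing it by the appropriate count leaves quotients whose limits are known.\<close>
    have "?L (g i) z / real (k z) \<le> ?L (g i) z / ?N (g (Suc i)) z"
      using i gi L0 by (intro divide_left_mono) auto
    moreover have "?L (g (Suc i)) z / ?N (g i) z \<le> ?L (g (Suc i)) z / real (k z)"
      using i gi L0 by (intro divide_left_mono) auto
    ultimately show ?case using between gi by (simp add: dist_real_def abs_less_iff)
  qed
qed

section \<open>The truncated sample\<close>

text \<open>Here \<open>n\<close> and \<omega> are fixed: these are deterministic comparisons on the
  event that every \<open>R j\<close> that enters the sample lies between 0 and
  \<open>\<epsilon> * M n\<close>.\<close>

context
  fixes M :: "nat \<Rightarrow> real" and H R :: "nat \<Rightarrow> 'a \<Rightarrow> real" and n :: nat and \<omega> :: 'a and \<epsilon> :: real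
  assumes M: "0 < M n"
    and R: "\<And>j. j \<in> {1..n} \<Longrightarrow> M n < H j \<omega> \<Longrightarrow> 0 \<le> R j \<omega> \<and> R j \<omega> \<le> \<epsilon> * M n"
begin

lemma trunc_sample_cases:
  assumes "j \<in> {1..n}"
  shows "H j \<omega> \<le> M n \<and> trunc_sample M H R n \<omega> j = H j \<omega> \<or>
    M n < H j \<omega> \<and> M n \<le> trunc_sample M H R n \<omega> j \<and> trunc_sample M H R n \<omega> j \<le> (1 + \<epsilon>) * M n"
  using R[OF assms] by (auto simp: trunc_sample_def algebra_simps)

text \<open>Truncation moves only points above \<open>M n\<close> and leaves them at or above it;
  the strict inequality covers a point moved exactly to \<open>M n\<close>.\<close>

lemma tail_count_trunc_sample:
  assumes "t < M n"
  shows "tail_count (trunc_sample M H R n \<omega>) n t = tail_count (\<lambda>j. H j \<omega>) n t"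
  unfolding tail_count_def
proof (rule sum.cong)
  fix j assume "j \<in> {1..n}"
  from trunc_sample_cases[OF this] assms
  show "of_bool (t < trunc_sample M H R n \<omega> j) = (of_bool (t < H j \<omega>) :: real)" by auto
qed simp

text \<open>Only points above \<open>M n\<close> change. Measured from \<open>M n\<close>, a moved
  point has logarithm at most \<open>ln (1 + \<epsilon>)\<close>, and the original one contributes
  its own excess over \<open>M n\<close>.\<close>

lemma log_excess_trunc_sample:
  assumes t: "0 < t" "t \<le> M n" and \<epsilon>: "0 \<le> \<epsilon>"
  shows "\<bar>log_excess (trunc_sample M H R n \<omega>) n t - log_excess (\<lambda>j. H j \<omega>) n t\<bar> \<le>
    ln (1 + \<epsilon>) * tail_count (\<lambda>j. H j \<omega>) n (M n) + log_excess (\<lambda>j. H j \<omega>) n (M n)"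
proof -
  let ?X = "trunc_sample M H R n \<omega>"
  have "\<bar>log_excess ?X n t - log_excess (\<lambda>j. H j \<omega>) n t\<bar> \<le>
      (\<Sum>j=1..n. \<bar>ln (max 1 (?X j / t)) - ln (max 1 (H j \<omega> / t))\<bar>)"
    unfolding log_excess_def sum_subtractf[symmetric] by (rule sum_abs)
  also have "\<dots> \<le> (\<Sum>j=1..n. ln (1 + \<epsilon>) * of_bool (M n < H j \<omega>) + ln (max 1 (H j \<omega> / M n)))"
  proof (rule sum_mono)
    fix j assume "j \<in> {1..n}"
    from trunc_sample_cases[OF this]
    show "\<bar>ln (max 1 (?X j / t)) - ln (max 1 (H j \<omega> / t))\<bar> \<le>
      ln (1 + \<epsilon>) * of_bool (M n < H j \<omega>) + ln (max 1 (H j \<omega> / M n))"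
    proof (elim disjE conjE)
      assume h: "M n < H j \<omega>" "M n \<le> ?X j" "?X j \<le> (1 + \<epsilon>) * M n"
      \<comment> \<open>The part of the logarithm between \<open>t\<close> and \<open>M n\<close> is
        common to both points and cancels, so the bound is free of \<open>t\<close>.\<close>
      have split: "ln (max 1 (x / t)) = ln (x / M n) + ln (M n) - ln t" if "M n \<le> x" for x
        using that t M by (simp add: max_absorb2 ln_div)
      have "0 \<le> ln (?X j / M n)" using h M by simp
      moreover have "ln (?X j / M n) \<le> ln (1 + \<epsilon>)"
        using h M \<epsilon> by (subst ln_le_cancel_iff) (auto simp: pos_divide_le_eq)
      moreover have "0 \<le> ln (H j \<omega> / M n)" "max 1 (H j \<omega> / M n) = H j \<omega> / M n"
        using h M by (simp_all add: max_absorb2)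
      ultimately have "\<bar>ln (?X j / M n) - ln (H j \<omega> / M n)\<bar> \<le> ln (1 + \<epsilon>) + ln (H j \<omega> / M n)"
        by (intro abs_leI) linarith+
      then show ?thesis using h split \<open>max 1 (H j \<omega> / M n) = H j \<omega> / M n\<close> by simp
    qed (use \<epsilon> in auto)
  qed
  finally show ?thesis
    unfolding tail_count_def log_excess_def by (simp only: sum.distrib sum_distrib_left)
qed

lemma Max_trunc_sample:
  assumes "0 < tail_count (\<lambda>j. H j \<omega>) n (M n)" and \<epsilon>: "0 \<le> \<epsilon>"
  shows "M n \<le> Max (trunc_sample M H R n \<omega> ` {1..n})"
    and "Max (trunc_sample M H R n \<omega> ` {1..n}) \<le> (1 + \<epsilon>) * M n"
proof -
  let ?X = "trunc_sample M H R n \<omega>"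
  have "\<exists>j\<in>{1..n}. M n < H j \<omega>"
  proof (rule ccontr)
    assume "\<not> (\<exists>j\<in>{1..n}. M n < H j \<omega>)"
    then have "tail_count (\<lambda>j. H j \<omega>) n (M n) = 0"
      unfolding tail_count_def by (intro sum.neutral) auto
    then show False using assms by simp
  qed
  then obtain j where j: "j \<in> {1..n}" "M n < H j \<omega>" by blast
  then have "M n \<le> ?X j" using trunc_sample_cases[OF j(1)] by auto
  also have "?X j \<le> Max (?X ` {1..n})" using j by (intro Max_ge) auto
  finally show "M n \<le> Max (?X ` {1..n})" .
  have "M n \<le> (1 + \<epsilon>) * M n" using M \<epsilon> by simp
  then have "?X i \<le> (1 + \<epsilon>) * M n" if "i \<in> {1..n}" for i
    using trunc_sample_cases[OF that] by linarith
  then show "Max (?X ` {1..n}) \<le> (1 + \<epsilon>) * M n" using j by (intro Max.boundedI) auto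
qed

end

lemma real_nat_floor_bounds:
  assumes "2 \<le> (x :: real)"
  shows "x / 2 \<le> real (nat \<lfloor>x\<rfloor>)" "real (nat \<lfloor>x\<rfloor>) \<le> x"
  using assms by linarith+

section \<open>The probabilistic setting of hard truncation\<close>

locale hard_truncation = prob_space P for P :: "'a measure" +
  fixes H R :: "nat \<Rightarrow> 'a \<Rightarrow> real" and M :: "nat \<Rightarrow> real" and \<alpha> :: real
  assumes \<alpha>: "0 < \<alpha>"
    and iid_H: "iid P H"
    and rv: "regularly_varying (tail_prob P (H 1)) (- \<alpha>)"
    and iid_R: "iid P R"
    and R_nonneg: "\<And>j. 1 \<le> j \<Longrightarrow> AE \<omega> in P. 0 \<le> R j \<omega>"
    and indep: "indep_seqs P H R"
    and M_lim: "filterlim M at_top sequentially"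
    and hard: "filterlim (\<lambda>n. real n * tail_prob P (H 1) (M n)) at_top sequentially"
    and R_small: "\<And>\<epsilon>. 0 < \<epsilon> \<Longrightarrow>
      (\<lambda>n. tail_prob P (H 1) (M n) * tail_prob P (R 1) (\<epsilon> * M n)) \<in> o(\<lambda>n. 1 / real n)"
begin

declare One_nat_def [simp del]

abbreviation F :: "real \<Rightarrow> real" where "F \<equiv> tail_prob P (H 1)"
abbreviation X :: "nat \<Rightarrow> 'a \<Rightarrow> nat \<Rightarrow> real" where "X \<equiv> trunc_sample M H R"

lemma iid_measurable: "iid P Y \<Longrightarrow> 1 \<le> j \<Longrightarrow> random_variable borel (Y j)"
  unfolding iid_def indep_vars_def by auto

lemma iid_tail_prob:
  assumes "iid P Y" "1 \<le> j"
  shows "prob {\<omega> \<in> space P. x < Y j \<omega>} = tail_prob P (Y 1) x"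
proof -
  have meas: "measure (distr P borel (Y i)) {x<..} = prob {\<omega> \<in> space P. x < Y i \<omega>}" if "1 \<le> i" for i
    using iid_measurable[OF assms(1) that]
    by (subst measure_distr) (auto simp: vimage_def Int_def conj_commute)
  have "distr P borel (Y j) = distr P borel (Y 1)" using assms unfolding iid_def by blast
  then show ?thesis using meas[of j] meas[of 1] assms(2) by (simp add: tail_prob_def)
qed

lemma antimono_F: "antimono F"
  using iid_measurable[OF iid_H] by (intro antimono_tail_prob) simp

text \<open>Regular variation yields positivity far out, and monotonicity carries it back to every
  \<open>x\<close>.\<close>

lemma F_pos: "0 < F x"
proof -
  have "\<forall>\<^sub>F y in at_top. 0 < F y" using rv by (simp add: regularly_varying_def)
  then have "\<forall>\<^sub>F y in at_top. 0 < F y \<and> x \<le> y" using eventually_ge_at_top by (rule eventually_conj)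
  then obtain y where "0 < F y" "x \<le> y" using eventually_happens'[OF trivial_limit_at_top_linorder] by blast
  then show ?thesis using antimono_F by (auto simp: antimono_def intro: less_le_trans)
qed

lemma F_tendsto_0: "(F \<longlongrightarrow> 0) at_top"
  using iid_measurable[OF iid_H] by (intro tail_prob_tendsto_0) simp

text \<open>Independence of the two sequences passes to their \<open>j\<close>-th coordinates, so
  the probability factors.\<close>

lemma joint_tail_prob:
  assumes j: "1 \<le> j"
  shows "prob {\<omega> \<in> space P. x < H j \<omega> \<and> y < R j \<omega>} = F x * tail_prob P (R 1) y"
proof -
  have "indep_var borel ((\<lambda>f. f j) \<circ> (\<lambda>\<omega>. \<lambda>j\<in>{1..}. H j \<omega>)) borel ((\<lambda>f. f j) \<circ> (\<lambda>\<omega>. \<lambda>j\<in>{1..}. R j \<omega>))"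
    using indep unfolding indep_seqs_def
    by (rule indep_var_compose) (use j in \<open>auto intro!: measurable_component_singleton\<close>)
  then have ind: "indep_var borel (H j) borel (R j)"
    using j by (simp add: comp_def)
  have "prob {\<omega> \<in> space P. x < H j \<omega> \<and> y < R j \<omega>} =
      prob ((\<lambda>\<omega>. (H j \<omega>, R j \<omega>)) -` ({x<..} \<times> {y<..}) \<inter> space P)"
    by (rule arg_cong[where f=prob]) auto
  also have "\<dots> = prob (H j -` {x<..} \<inter> space P) * prob (R j -` {y<..} \<inter> space P)"
    using ind by (rule indep_varD) auto
  also have "\<dots> = prob {\<omega> \<in> space P. x < H j \<omega>} * prob {\<omega> \<in> space P. y < R j \<omega>}"
    by (intro arg_cong2[where f="(*)"] arg_cong[where f=prob]) auto
  finally show ?thesis using j by (simp add: iid_tail_prob[OF iid_H] iid_tail_prob[OF iid_R])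
qed

text \<open>A union bound over the sample: the failure probability is at most \<open>n\<close> times
  the product in \<open>R_small\<close>, which is \<open>o(1 / n)\<close>. Only indices with
  \<open>H j\<close> above \<open>M n\<close> matter, since elsewhere \<open>R j\<close> does not
  enter the sample.\<close>

lemma eventually_R_bounded:
  assumes \<epsilon>: "0 < \<epsilon>"
  shows "\<forall>\<^sub>F z in whp P. \<forall>j\<in>{1..fst z}. M (fst z) < H j (snd z) \<longrightarrow>
    0 \<le> R j (snd z) \<and> R j (snd z) \<le> \<epsilon> * M (fst z)"
proof -
  define B where "B n j = {\<omega> \<in> space P. M n < H j \<omega> \<and> \<epsilon> * M n < R j \<omega>}" for n j
  have B: "B n j \<in> events" if "1 \<le> j" for n j
  proof -
    note iid_measurable[OF iid_H that, measurable] iid_measurable[OF iid_R that, measurable]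
    show ?thesis unfolding B_def by measurable
  qed
  have "\<forall>\<^sub>F z in whp P. snd z \<in> space P \<and> (\<forall>j\<in>{1..fst z}. snd z \<notin> B (fst z) j)"
  proof (rule eventually_whpI[where B="\<lambda>n. \<Union>j\<in>{1..n}. B n j"])
    show "(\<Union>j\<in>{1..n}. B n j) \<in> events" for n using B by (intro sets.finite_UN) auto
    show "(\<lambda>n. prob (\<Union>j\<in>{1..n}. B n j)) \<longlonglongrightarrow> 0"
    proof (rule tendsto_sandwich[OF always_eventually always_eventually tendsto_const])
      have "(\<lambda>n. F (M n) * tail_prob P (R 1) (\<epsilon> * M n) / (1 / real n)) \<longlonglongrightarrow> 0"
        by (rule smalloD_tendsto[OF R_small[OF \<epsilon>]])
      then show "(\<lambda>n. real n * (F (M n) * tail_prob P (R 1) (\<epsilon> * M n))) \<longlonglongrightarrow> 0"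
        by (simp add: mult.commute)
      show "\<forall>n. prob (\<Union>j\<in>{1..n}. B n j) \<le> real n * (F (M n) * tail_prob P (R 1) (\<epsilon> * M n))"
      proof
        fix n
        have "prob (\<Union>j\<in>{1..n}. B n j) \<le> (\<Sum>j\<in>{1..n}. prob (B n j))"
          using B by (intro measure_UNION_le) auto
        also have "\<dots> = (\<Sum>j\<in>{1..n}. F (M n) * tail_prob P (R 1) (\<epsilon> * M n))"
          unfolding B_def by (intro sum.cong joint_tail_prob) auto
        finally show "prob (\<Union>j\<in>{1..n}. B n j) \<le> real n * (F (M n) * tail_prob P (R 1) (\<epsilon> * M n))"
          by simp
      qed
    qed simp
  qed auto
  moreover have "\<forall>\<^sub>F z in whp P. \<forall>j\<in>{1..}. 0 \<le> R j (snd z)"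
    using R_nonneg by (intro AE_imp_eventually_whp AE_ball_countable[THEN iffD2]) auto
  ultimately show ?thesis
    by eventually_elim (auto simp: B_def not_less)
qed

lemma eventually_M_pos: "\<forall>\<^sub>F n in sequentially. 0 < M n"
  using M_lim unfolding filterlim_at_top_dense by blast

lemma F_ratio_tendsto:
  assumes "filterlim t at_top sequentially" "0 < s"
  shows "(\<lambda>n. F (s * t n) / F (t n)) \<longlonglongrightarrow> s powr - \<alpha>"
  by (rule filterlim_compose[OF regularly_varying_tendsto[OF rv assms(2)] assms(1)])

end

text \<open>The limits are those of the untruncated sample. Truncation acts at \<open>M n\<close>,
  which lies above \<open>s * t n\<close>, so counts agree; the log-excess changes by an amount of
  order \<open>n * F (M n)\<close>, negligible against \<open>n * F (t n)\<close>.\<close>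

lemma (in hard_truncation) tendsto_sample_statistics:
  assumes t: "filterlim t at_top sequentially"
    and small: "(\<lambda>n. F (M n) / F (t n)) \<longlonglongrightarrow> 0" and s: "0 < s"
  shows "((\<lambda>z. tail_count (X (fst z) (snd z)) (fst z) (s * t (fst z)) / (real (fst z) * F (t (fst z))))
      \<longlongrightarrow> s powr - \<alpha>) (whp P)"
    and "((\<lambda>z. log_excess (X (fst z) (snd z)) (fst z) (s * t (fst z)) / (real (fst z) * F (t (fst z))))
      \<longlongrightarrow> s powr - \<alpha> / \<alpha>) (whp P)"
proof -
  let ?h = "\<lambda>z j. H j (snd z)"
  note ratio = F_ratio_tendsto[OF t s]
  have st: "filterlim (\<lambda>n. s * t n) at_top sequentially"
    using s t by (intro filterlim_tendsto_pos_mult_at_top[OF tendsto_const])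
  have small': "(\<lambda>n. F (M n) / F (s * t n)) \<longlonglongrightarrow> 0"
  proof -
    have "(\<lambda>n. (F (M n) / F (t n)) / (F (s * t n) / F (t n))) \<longlonglongrightarrow> 0 / s powr - \<alpha>"
      using s by (intro tendsto_divide small ratio) simp
    then show ?thesis using F_pos by (simp add: less_imp_neq[symmetric])
  qed
  have less: "\<forall>\<^sub>F n in sequentially. F (M n) < F (s * t n)"
    using order_tendstoD(2)[OF small' zero_less_one] by eventually_elim (simp add: F_pos pos_divide_less_eq)
  have st_M: "\<forall>\<^sub>F n in sequentially. s * t n < M n"
    using less
  proof eventually_elim
    case (elim n)
    then show ?case using antimono_F unfolding antimono_def by (meson not_less)
  qed
  have lim_st: "filterlim (\<lambda>n. real n * F (s * t n)) at_top sequentially"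
    by (rule filterlim_at_top_mono[OF hard])
      (use less in eventually_elim, auto intro!: mult_left_mono)
  have st_pos: "\<forall>\<^sub>F n in sequentially. 0 < s * t n"
    using st unfolding filterlim_at_top_dense by blast
  \<comment> \<open>Passing from the normalisation at \<open>s * t n\<close> to the one at
    \<open>t n\<close> produces the factor \<open>s powr - \<alpha>\<close>.\<close>
  have transfer: "((\<lambda>z. Y z / (real (fst z) * F (t (fst z)))) \<longlongrightarrow> c * s powr - \<alpha>) (whp P)"
    if "((\<lambda>z. Y z / (real (fst z) * F (s * t (fst z)))) \<longlongrightarrow> c) (whp P)" for Y :: "nat \<times> 'a \<Rightarrow> real" and c
  proof (rule Lim_transform_eventually[OF tendsto_mult[OF that tendsto_whp_fst[OF ratio]]])
    show "\<forall>\<^sub>F z in whp P. Y z / (real (fst z) * F (s * t (fst z))) * (F (s * t (fst z)) / F (t (fst z))) =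
        Y z / (real (fst z) * F (t (fst z)))"
      using F_pos by (intro always_eventually allI) (simp add: less_imp_neq[symmetric])
  qed
  have count: "((\<lambda>z. tail_count (?h z) (fst z) (s * t (fst z)) / (real (fst z) * F (t (fst z))))
      \<longlongrightarrow> s powr - \<alpha>) (whp P)"
    using transfer[OF tail_count_tendsto_whp[OF iid_H rv \<alpha> st lim_st]] by simp
  have excess: "((\<lambda>z. log_excess (?h z) (fst z) (s * t (fst z)) / (real (fst z) * F (t (fst z))))
      \<longlongrightarrow> s powr - \<alpha> / \<alpha>) (whp P)"
    using transfer[OF log_excess_tendsto_whp[OF iid_H rv \<alpha> st lim_st]] by simp
  \<comment> \<open>The value 1 for \<epsilon> is convenient: a fixed multiple of
    \<open>n * F (M n)\<close> is a good enough error, and it gives the constant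
    \<open>ln 2\<close>.\<close>
  note ev = eventually_R_bounded[of 1, simplified] eventually_whp_fst[OF eventually_M_pos]
    eventually_whp_fst[OF st_M] eventually_whp_fst[OF st_pos]
  show "((\<lambda>z. tail_count (X (fst z) (snd z)) (fst z) (s * t (fst z)) / (real (fst z) * F (t (fst z))))
      \<longlongrightarrow> s powr - \<alpha>) (whp P)"
  proof (rule Lim_transform_eventually[OF count])
    show "\<forall>\<^sub>F z in whp P.
        tail_count (?h z) (fst z) (s * t (fst z)) / (real (fst z) * F (t (fst z))) =
        tail_count (X (fst z) (snd z)) (fst z) (s * t (fst z)) / (real (fst z) * F (t (fst z)))"
      using ev
    proof eventually_elim
      case (elim z)
      then have "tail_count (X (fst z) (snd z)) (fst z) (s * t (fst z)) =
          tail_count (?h z) (fst z) (s * t (fst z))"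
        by (intro tail_count_trunc_sample[where \<epsilon>=1]) auto
      then show ?case by simp
    qed
  qed
  let ?D = "\<lambda>z. (log_excess (X (fst z) (snd z)) (fst z) (s * t (fst z)) -
    log_excess (?h z) (fst z) (s * t (fst z))) / (real (fst z) * F (t (fst z)))"
  let ?U = "\<lambda>z. (ln 2 * (tail_count (?h z) (fst z) (M (fst z)) / (real (fst z) * F (M (fst z)))) +
      log_excess (?h z) (fst z) (M (fst z)) / (real (fst z) * F (M (fst z)))) *
      (F (M (fst z)) / F (t (fst z)))"
  have "(?U \<longlongrightarrow> (ln 2 * 1 + 1 / \<alpha>) * 0) (whp P)"
    by (intro tendsto_mult tendsto_add tendsto_const
        tail_count_tendsto_whp[OF iid_H rv \<alpha> M_lim hard]
        log_excess_tendsto_whp[OF iid_H rv \<alpha> M_lim hard] tendsto_whp_fst[OF small])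
  then have U: "(?U \<longlongrightarrow> 0) (whp P)" by simp
  have "(?D \<longlongrightarrow> 0) (whp P)"
  proof (rule Lim_null_comparison[OF _ U])
    show "\<forall>\<^sub>F z in whp P. norm (?D z) \<le> ?U z"
      using ev
    proof eventually_elim
      case (elim z)
      obtain n \<omega> where z: "z = (n, \<omega>)" by (cases z)
      have "norm (?D z) = \<bar>log_excess (X n \<omega>) n (s * t n) - log_excess (\<lambda>j. H j \<omega>) n (s * t n)\<bar> /
          (real n * F (t n))"
        using F_pos[of "t n"] by (simp add: z abs_mult)
      also have "\<dots> \<le> (ln (1 + 1) * tail_count (\<lambda>j. H j \<omega>) n (M n) + log_excess (\<lambda>j. H j \<omega>) n (M n)) /
          (real n * F (t n))"
        using elim F_pos[of "t n"]
        by (intro divide_right_mono log_excess_trunc_sample) (auto simp: z less_imp_le)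
      also have "\<dots> = ?U z"
        using F_pos[of "t n"] F_pos[of "M n"] by (cases "n = 0") (simp_all add: z field_simps)
      finally show ?case .
    qed
  qed
  from tendsto_add[OF excess this]
  show "((\<lambda>z. log_excess (X (fst z) (snd z)) (fst z) (s * t (fst z)) / (real (fst z) * F (t (fst z))))
      \<longlongrightarrow> s powr - \<alpha> / \<alpha>) (whp P)"
    by (simp add: diff_divide_distrib)
qed

text \<open>The maximum is so close to \<open>M n\<close> that \<gamma> times it lies between
  \<open>\<gamma> * M n\<close> and \<open>M n\<close>. The count defining \<open>k_hat\<close> is
  therefore squeezed between two counts, both of the order of \<open>n * F (M n)\<close>.\<close>

lemma (in hard_truncation) eventually_k_hat_bounds:
  assumes \<gamma>: "0 < \<gamma>" "\<gamma> < 1" and \<beta>: "0 < \<beta>" "\<beta> < 1"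
  shows "\<exists>G>0. \<forall>\<^sub>F z in whp P.
    real (fst z) * (1 / 2 * F (M (fst z))) powr \<beta> / 2 \<le> real (k_hat \<gamma> \<beta> (X (fst z) (snd z)) (fst z)) \<and>
    real (k_hat \<gamma> \<beta> (X (fst z) (snd z)) (fst z)) \<le> real (fst z) * (G * F (M (fst z))) powr \<beta>"
proof (intro exI conjI)
  let ?h = "\<lambda>z j. H j (snd z)"
  \<comment> \<open>The limiting ratio of the count at \<open>\<gamma> * M n\<close> to
    \<open>n * F (M n)\<close>, plus slack 1.\<close>
  define G where "G = \<gamma> powr - \<alpha> + 1"
  show G: "0 < G" unfolding G_def by (simp add: add_nonneg_pos)
  \<comment> \<open>With this choice \<open>\<gamma> * (1 + \<epsilon>)\<close> is
    \<open>(1 + \<gamma>) / 2\<close>, hence below 1.\<close>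
  define \<epsilon> where "\<epsilon> = (1 / \<gamma> - 1) / 2"
  have \<epsilon>: "0 < \<epsilon>" "\<gamma> * (1 + \<epsilon>) < 1" using \<gamma> by (auto simp: \<epsilon>_def field_simps)
  have \<gamma>M: "filterlim (\<lambda>n. \<gamma> * M n) at_top sequentially"
    using \<gamma> M_lim by (intro filterlim_tendsto_pos_mult_at_top[OF tendsto_const])
  have F_le: "\<forall>\<^sub>F n in sequentially. F (M n) \<le> F (\<gamma> * M n)"
    using eventually_M_pos
  proof eventually_elim
    case (elim n)
    then have "\<gamma> * M n \<le> M n" using \<gamma> by simp
    then show ?case using antimono_F by (simp add: antimono_def)
  qed
  have hard\<gamma>: "filterlim (\<lambda>n. real n * F (\<gamma> * M n)) at_top sequentially"
    by (rule filterlim_at_top_mono[OF hard])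
      (use F_le in eventually_elim, auto intro!: mult_left_mono)
  have "((\<lambda>z. tail_count (?h z) (fst z) (\<gamma> * M (fst z)) / (real (fst z) * F (\<gamma> * M (fst z))) *
      (F (\<gamma> * M (fst z)) / F (M (fst z)))) \<longlongrightarrow> 1 * \<gamma> powr - \<alpha>) (whp P)"
    using \<gamma> by (intro tendsto_mult tail_count_tendsto_whp[OF iid_H rv \<alpha> \<gamma>M hard\<gamma>]
        tendsto_whp_fst F_ratio_tendsto M_lim)
  then have "((\<lambda>z. tail_count (?h z) (fst z) (\<gamma> * M (fst z)) / (real (fst z) * F (M (fst z))))
      \<longlongrightarrow> \<gamma> powr - \<alpha>) (whp P)"
    using F_pos by (simp add: less_imp_neq[symmetric])
  then have upper: "\<forall>\<^sub>F z in whp P. tail_count (?h z) (fst z) (\<gamma> * M (fst z)) / (real (fst z) * F (M (fst z))) < G"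
    by (rule order_tendstoD) (simp add: G_def)
  have lower: "\<forall>\<^sub>F z in whp P. 1 / 2 < tail_count (?h z) (fst z) (M (fst z)) / (real (fst z) * F (M (fst z)))"
    by (rule order_tendstoD(1)[OF tail_count_tendsto_whp[OF iid_H rv \<alpha> M_lim hard]]) simp
  \<comment> \<open>The bound 4 becomes 2 after the factor \<open>1 / 2\<close> in the lower bound
    for the count; from 2 on, the integer part is at least half of its argument.\<close>
  have large: "\<forall>\<^sub>F n in sequentially. 4 \<le> real n * F (M n)"
    using hard unfolding filterlim_at_top by blast
  show "\<forall>\<^sub>F z in whp P.
    real (fst z) * (1 / 2 * F (M (fst z))) powr \<beta> / 2 \<le> real (k_hat \<gamma> \<beta> (X (fst z) (snd z)) (fst z)) \<and>
    real (k_hat \<gamma> \<beta> (X (fst z) (snd z)) (fst z)) \<le> real (fst z) * (G * F (M (fst z))) powr \<beta>"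
    using upper lower eventually_R_bounded[OF \<epsilon>(1)] eventually_whp_fst[OF eventually_M_pos]
      eventually_whp_fst[OF large]
  proof eventually_elim
    case (elim z)
    obtain n \<omega> where z: "z = (n, \<omega>)" by (cases z)
    let ?N = "tail_count (\<lambda>j. H j \<omega>) n" and ?p = "F (M n)"
    let ?max = "Max (X n \<omega> ` {1..n})"
    define N where "N = tail_count (X n \<omega>) n (\<gamma> * ?max)"
    have np: "4 \<le> real n * ?p" and M0: "0 < M n" using elim by (simp_all add: z)
    then have n: "0 < real n" using F_pos[of "M n"] by (cases n) auto
    have R: "\<And>j. j \<in> {1..n} \<Longrightarrow> M n < H j \<omega> \<Longrightarrow> 0 \<le> R j \<omega> \<and> R j \<omega> \<le> \<epsilon> * M n"
      using elim by (simp add: z)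
    have N_M: "real n * ?p / 2 < ?N (M n)" and N_\<gamma>: "?N (\<gamma> * M n) < G * (real n * ?p)"
      using elim np by (simp_all add: z pos_less_divide_eq pos_divide_less_eq)
    have max: "M n \<le> ?max" "?max \<le> (1 + \<epsilon>) * M n"
      by (rule Max_trunc_sample[where \<epsilon>=\<epsilon>]; use R M0 N_M np \<epsilon> in auto)+
    have "\<gamma> * ?max \<le> \<gamma> * ((1 + \<epsilon>) * M n)" using \<gamma> max by (intro mult_left_mono) auto
    also have "\<dots> < M n" using \<epsilon>(2) M0 by (simp add: mult.assoc[symmetric])
    finally have max_M: "\<gamma> * ?max < M n" .
    have N_eq: "N = ?N (\<gamma> * ?max)"
      unfolding N_def using R M0 max_M by (intro tail_count_trunc_sample[where \<epsilon>=\<epsilon>]) auto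
    have "real n * ?p / 2 \<le> N"
      using N_M tail_count_antimono[of "\<gamma> * ?max" "M n" "\<lambda>j. H j \<omega>" n] max_M by (simp add: N_eq)
    then have lo: "1 / 2 * ?p \<le> N / real n" using n by (simp add: field_simps)
    have "N \<le> G * (real n * ?p)"
      using N_\<gamma> tail_count_antimono[of "\<gamma> * M n" "\<gamma> * ?max" "\<lambda>j. H j \<omega>" n] max \<gamma> by (simp add: N_eq)
    then have hi: "N / real n \<le> G * ?p" using n by (simp add: field_simps)
    have p: "0 < ?p" "?p \<le> 1" using F_pos by (auto simp: tail_prob_def)
    have "0 \<le> N / real n" unfolding N_def by (simp add: tail_count_nonneg)
    have lo': "(1 / 2 * ?p) powr \<beta> \<le> (N / real n) powr \<beta>"
      using lo p \<beta> by (intro powr_mono2) auto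
    have hi': "(N / real n) powr \<beta> \<le> (G * ?p) powr \<beta>"
      using hi \<open>0 \<le> N / real n\<close> \<beta> by (intro powr_mono2) auto
    let ?x = "real n * (N / real n) powr \<beta>"
    have "2 \<le> real n * (1 / 2 * ?p)" using np by simp
    \<comment> \<open>The base is at most 1, so lowering the exponent from 1 to \<beta> increases
      the power.\<close>
    also have "\<dots> \<le> real n * (1 / 2 * ?p) powr \<beta>"
      using powr_mono'[of \<beta> 1 "1 / 2 * ?p"] p \<beta> n by simp
    also have "\<dots> \<le> ?x" using lo' n by simp
    finally have "2 \<le> ?x" .
    have k: "k_hat \<gamma> \<beta> (X n \<omega>) n = nat \<lfloor>?x\<rfloor>" by (simp add: k_hat_eq N_def)
    have "real n * (1 / 2 * ?p) powr \<beta> / 2 \<le> ?x / 2" using lo' n by simp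
    then have "real n * (1 / 2 * ?p) powr \<beta> / 2 \<le> real (nat \<lfloor>?x\<rfloor>)"
      using real_nat_floor_bounds(1)[OF \<open>2 \<le> ?x\<close>] by (rule order_trans)
    moreover have "?x \<le> real n * (G * ?p) powr \<beta>" using hi' n by simp
    with real_nat_floor_bounds(2)[OF \<open>2 \<le> ?x\<close>]
    have "real (nat \<lfloor>?x\<rfloor>) \<le> real n * (G * ?p) powr \<beta>" by (rule order_trans)
    ultimately show ?case by (simp only: z k fst_conv snd_conv)
  qed
qed

text \<open>The sandwich is applied at a scale \<open>t n\<close> where the tail matches the order
  of \<open>k_hat\<close> divided by \<open>n\<close>, namely
  \<open>F (M n) powr \<beta>\<close>.\<close>

lemma (in hard_truncation) tendsto_hill_k_hat:
  assumes \<gamma>: "0 < \<gamma>" "\<gamma> < 1" and \<beta>: "0 < \<beta>" "\<beta> < 1"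
  shows "((\<lambda>z. hill (X (fst z) (snd z)) (fst z) (k_hat \<gamma> \<beta> (X (fst z) (snd z)) (fst z))) \<longlongrightarrow> 1 / \<alpha>) (whp P)"
proof -
  have p: "(\<lambda>n. F (M n)) \<longlonglongrightarrow> 0" by (rule filterlim_compose[OF F_tendsto_0 M_lim])
  have "(\<lambda>n. F (M n) powr \<beta>) \<longlonglongrightarrow> 0"
    using tendsto_powr'[OF p tendsto_const, of \<beta>] F_pos \<beta> by (simp add: less_imp_le)
  then obtain t where t: "filterlim t at_top sequentially"
    and t_F: "\<forall>\<^sub>F n in sequentially. F (t n) \<le> F (M n) powr \<beta> \<and> F (M n) powr \<beta> < F (t n / 2)"
    using ex_tail_quantile[OF antimono_F F_pos F_tendsto_0, of "\<lambda>n. F (M n) powr \<beta>"] F_pos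
    by (auto simp: less_imp_neq[symmetric])
  \<comment> \<open>A strict upper bound for the limit of \<open>F (t n / 2) / F (t n)\<close>; it
    turns the quantile bracket into \<open>F (M n) powr \<beta> < D * F (t n)\<close>.\<close>
  define D where "D = (1 / 2) powr - \<alpha> + 1"
  have D: "0 < D" unfolding D_def by (simp add: add_nonneg_pos)
  have half: "\<forall>\<^sub>F n in sequentially. F (t n / 2) < D * F (t n)"
    using order_tendstoD(2)[OF F_ratio_tendsto[OF t, of "1 / 2"], of D]
    by (rule eventually_mono) (auto simp: D_def F_pos pos_divide_less_eq)
  \<comment> \<open>This is where \<open>\<beta> < 1\<close> enters: the ratio is at most
    \<open>D * F (M n) powr (1 - \<beta>)\<close>, and the exponent is positive.\<close>
  have small: "(\<lambda>n. F (M n) / F (t n)) \<longlonglongrightarrow> 0"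
  proof (rule tendsto_sandwich[OF _ _ tendsto_const])
    have "(\<lambda>n. D * F (M n) powr (1 - \<beta>)) \<longlonglongrightarrow> D * 0"
      using tendsto_powr'[OF p tendsto_const, of "1 - \<beta>"] F_pos \<beta>
      by (intro tendsto_mult tendsto_const) (simp add: less_imp_le)
    then show "(\<lambda>n. D * F (M n) powr (1 - \<beta>)) \<longlonglongrightarrow> 0" by simp
    show "\<forall>\<^sub>F n in sequentially. F (M n) / F (t n) \<le> D * F (M n) powr (1 - \<beta>)"
      using half t_F
    proof eventually_elim
      case (elim n)
      have "F (M n) powr \<beta> \<le> D * F (t n)" using elim by simp
      then have "F (M n) powr (1 - \<beta>) * F (M n) powr \<beta> \<le> F (M n) powr (1 - \<beta>) * (D * F (t n))"
        by (intro mult_left_mono) auto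
      moreover have "F (M n) powr (1 - \<beta>) * F (M n) powr \<beta> = F (M n)"
        using F_pos[of "M n"] by (simp add: powr_add[symmetric])
      ultimately show ?case using F_pos[of "t n"] by (simp add: pos_divide_le_eq mult_ac)
    qed
    show "\<forall>\<^sub>F n in sequentially. 0 \<le> F (M n) / F (t n)"
      using F_pos by (simp add: less_imp_le)
  qed
  obtain G where G: "0 < G" "\<forall>\<^sub>F z in whp P.
    real (fst z) * (1 / 2 * F (M (fst z))) powr \<beta> / 2 \<le> real (k_hat \<gamma> \<beta> (X (fst z) (snd z)) (fst z)) \<and>
    real (k_hat \<gamma> \<beta> (X (fst z) (snd z)) (fst z)) \<le> real (fst z) * (G * F (M (fst z))) powr \<beta>"
    using eventually_k_hat_bounds[OF \<gamma> \<beta>] by blast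
  let ?v = "\<lambda>z. real (fst z) * F (t (fst z))" and ?k = "\<lambda>z. k_hat \<gamma> \<beta> (X (fst z) (snd z)) (fst z)"
  \<comment> \<open>The comparison constants: the bracket of the quantile combined with the two
    bounds on \<open>k_hat\<close>, with \<open>D\<close> paying for the jump of
    \<open>F\<close>.\<close>
  have c: "0 < (1 / 2) powr \<beta> / 2" "0 < G powr \<beta> * D" using D G by auto
  have "\<forall>\<^sub>F n in sequentially. 0 < t n" using t unfolding filterlim_at_top_dense by blast
  then have tv: "\<forall>\<^sub>F n in sequentially. 0 < t n \<and> 0 < real n * F (t n)"
    using eventually_gt_at_top[of 0] by eventually_elim (simp add: F_pos)
  have k: "\<forall>\<^sub>F z in whp P. (1 / 2) powr \<beta> / 2 * ?v z \<le> real (?k z) \<and> real (?k z) \<le> G powr \<beta> * D * ?v z"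
    using G(2) eventually_whp_fst[OF half] eventually_whp_fst[OF t_F]
  proof eventually_elim
    case (elim z)
    have "(1 / 2) powr \<beta> / 2 * ?v z = (1 / 2) powr \<beta> * F (t (fst z)) * (real (fst z) / 2)" by simp
    also have "\<dots> \<le> (1 / 2) powr \<beta> * F (M (fst z)) powr \<beta> * (real (fst z) / 2)"
      using elim by (intro mult_right_mono mult_left_mono) auto
    also have "\<dots> = real (fst z) * (1 / 2 * F (M (fst z))) powr \<beta> / 2"
      using F_pos[of "M (fst z)"] by (subst powr_mult) (auto simp: less_imp_le)
    also have "\<dots> \<le> real (?k z)" using elim by simp
    finally have lo: "(1 / 2) powr \<beta> / 2 * ?v z \<le> real (?k z)" .
    have "real (?k z) \<le> real (fst z) * (G * F (M (fst z))) powr \<beta>" using elim by simp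
    also have "\<dots> = real (fst z) * (G powr \<beta> * F (M (fst z)) powr \<beta>)"
      using F_pos[of "M (fst z)"] G(1) by (subst powr_mult) (auto simp: less_imp_le)
    also have "\<dots> \<le> real (fst z) * (G powr \<beta> * (D * F (t (fst z))))"
      using elim by (intro mult_left_mono) auto
    finally show ?case using lo by (simp add: mult_ac)
  qed
  have kn: "\<forall>\<^sub>F z in whp P. 1 \<le> ?k z \<and> ?k z \<le> fst z"
    using k eventually_whp_fst[OF tv]
  proof eventually_elim
    case (elim z)
    have "0 < (1 / 2) powr \<beta> / 2 * ?v z" by (rule mult_pos_pos[OF c(1)]) (use elim in simp)
    then have "0 < real (?k z)" using elim by linarith
    then show ?case using k_hat_le[OF \<beta>(1)] by simp
  qed
  show ?thesis
  proof (rule tendsto_hillI[OF \<alpha>])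
    show "\<forall>\<^sub>F z in whp P. 0 < t (fst z) \<and> 0 < ?v z" by (rule eventually_whp_fst[OF tv])
  qed (fact tendsto_sample_statistics[OF t small] kn k c)+
qed

theorem theorem3p2:
  fixes P :: "'a measure"
    and H R :: "nat \<Rightarrow> 'a \<Rightarrow> real"
    and M :: "nat \<Rightarrow> real"
    and \<alpha> \<beta> \<gamma> :: real
  assumes "prob_space P"
    and "0 < \<alpha>"
    and "iid P H"
    and "\<And>j. j \<ge> 1 \<Longrightarrow> AE \<omega> in P. 0 \<le> H j \<omega>"
    and "regularly_varying (\<lambda>x. measure P {\<omega> \<in> space P. H 1 \<omega> > x}) (- \<alpha>)"
    and "iid P R"
    and "\<And>j. j \<ge> 1 \<Longrightarrow> AE \<omega> in P. 0 \<le> R j \<omega>"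
    and "indep_seqs P H R"
    and "\<And>n. n \<ge> 1 \<Longrightarrow> 0 < M n"
    and "filterlim M at_top sequentially"
    and "filterlim (\<lambda>n. real n * measure P {\<omega> \<in> space P. H 1 \<omega> > M n}) at_top sequentially"
    and "\<And>\<epsilon>. 0 < \<epsilon> \<Longrightarrow>
           (\<lambda>n. measure P {\<omega> \<in> space P. H 1 \<omega> > M n} * measure P {\<omega> \<in> space P. R 1 \<omega> > \<epsilon> * M n})
             \<in> o(\<lambda>n. 1 / real n)"
    and "0 < \<gamma>" "\<gamma> < 1"
    and "0 < \<beta>" "\<beta> < 1"
  shows "converges_in_prob P
           (\<lambda>n \<omega>. hill (trunc_sample M H R n \<omega>) n (k_hat \<gamma> \<beta> (trunc_sample M H R n \<omega>) n))
           (1 / \<alpha>)"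
proof -
  interpret prob_space P by fact
  interpret hard_truncation P H R M \<alpha>
    by unfold_locales (use assms in \<open>simp_all add: tail_prob_def[abs_def]\<close>)
  show ?thesis
  proof (rule converges_in_prob_if_tendsto_whp)
    show "(\<lambda>\<omega>. hill (X n \<omega>) n (k_hat \<gamma> \<beta> (X n \<omega>) n)) \<in> borel_measurable P" for n
    proof (rule borel_measurable_hill_k_hat[OF _ \<open>0 < \<beta>\<close>])
      fix j :: nat assume "1 \<le> j"
      note iid_measurable[OF iid_H this, measurable] iid_measurable[OF iid_R this, measurable]
      show "(\<lambda>\<omega>. X n \<omega> j) \<in> borel_measurable P"
        unfolding trunc_sample_def by measurable
    qed
  qed (use tendsto_hill_k_hat assms in simp)
qed

end
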